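(* Let $F$ be a finite field with $q$ elements. Let $n\ge 1$ and let $\mathcal{A}_{n-1}\rightharpoonup\mathcal{A}_n$ be fixed Toeplitz matrices over $F$ with nullities $\nu_{n-1}$ and $\nu_n$. For an integer $c\geq 0$ write $\nu_{n-1},\nu_n\overset{M}{\rightarrow}c$ to mean that exactly $M$ Toeplitz matrices $\mathcal{A}_{n+1}$ over $F$ satisfy $\mathcal{A}_n\rightharpoonup\mathcal{A}_{n+1}$ and have nullity $\nu_{n+1}=c$. Then: (1) $0,0\overset{q^2-q+1}{\rightarrow}0$; (2) $0,0\overset{q-1}{\rightarrow}1$; (3) $1,0\overset{q^2-q}{\rightarrow}0$; (4) $1,0\overset{q}{\rightarrow}1$; (5) for $d\ge1$, $d-1,d\overset{1}{\rightarrow}d+1$; (6) for $d\ge1$, $d-1,d\overset{2q-2}{\rightarrow}d$; (7) for $d\ge1$, $d-1,d\overset{(q-1)^2}{\rightarrow}d-1$; (8) for $d\ge1$, $d,d\overset{q}{\rightarrow}d$; (9) for $d\ge1$, $d,d\overset{q^2-q}{\rightarrow}d-1$; (10) for $d\ge2$, $d,d-1\overset{q^2}{\rightarrow}d-2$.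
   Context: For an integer $n\ge0$, $\mathcal{A}_n$ denotes an $(n+1)\times(n+1)$ Toeplitz matrix over $F$: its $(i,j)$ entry ($0\le i,j\le n$) is $a_{j-i}$ if $j\ge i$ and $b_{i-j}$ if $i>j$, where $a_0,\dots,a_n,b_1,\dots,b_n\in F$. We write $\mathcal{A}_n\rightharpoonup\mathcal{A}_{n+1}$ if $\mathcal{A}_n$ is the top left $(n+1)\times(n+1)$ corner (equivalently the lower right corner) of $\mathcal{A}_{n+1}$; so given $\mathcal{A}_n$, such an $\mathcal{A}_{n+1}$ is determined by the pair of entries $(b_{n+1},a_{n+1})\in F^2$. The nullity of $\mathcal{A}_n$ is $\nu_n=\dim\ker(\mathcal{A}_n)$. *)

theory Defs
  imports "Jordan_Normal_Form.Matrix_Kernel"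
begin

text \<open>Only \<open>a 0, \<dots>, a n\<close> and \<open>b 1, \<dots>, b n\<close> enter the matrix; the size is \<open>n + 1\<close>, not \<open>n\<close>.\<close>

definition toeplitz_mat :: "nat \<Rightarrow> (nat \<Rightarrow> 'a) \<Rightarrow> (nat \<Rightarrow> 'a) \<Rightarrow> 'a mat" where
  "toeplitz_mat n a b =
     mat (n + 1) (n + 1) (\<lambda>(i, j). if i \<le> j then a (j - i) else b (i - j))"

definition is_toeplitz :: "nat \<Rightarrow> 'a mat \<Rightarrow> bool" where
  "is_toeplitz n A \<longleftrightarrow> (\<exists>a b. A = toeplitz_mat n a b)"

text \<open>The relation written \<open>\<A>\<^sub>n \<rightharpoonup> \<A>\<^sub>n\<^sub>+\<^sub>1\<close>: top left corner, both matrices being Toeplitz.\<close>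

definition toeplitz_ext :: "nat \<Rightarrow> 'a mat \<Rightarrow> 'a mat \<Rightarrow> bool" where
  "toeplitz_ext n A A' \<longleftrightarrow>
     is_toeplitz n A \<and> is_toeplitz (n + 1) A' \<and>
     A = mat (n + 1) (n + 1) (\<lambda>(i, j). A' $$ (i, j))"

text \<open>The number \<open>M\<close> in the notation \<open>\<nu>\<^sub>n\<^sub>-\<^sub>1, \<nu>\<^sub>n \<longrightarrow>\<^sup>M c\<close>. Over a finite field the set
  below is finite, so \<^const>\<open>card\<close> is an honest count.\<close>

definition num_ext_with_nullity :: "nat \<Rightarrow> 'a :: field mat \<Rightarrow> nat \<Rightarrow> nat" where
  "num_ext_with_nullity n A c = card {A'. toeplitz_ext n A A' \<and> kernel_dim A' = c}"

end

theory Submission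
  imports Defs "HOL-Computational_Algebra.Polynomial" "HOL-Library.Cardinality"
begin

text \<open>Over a field with \<open>q\<close> elements a space of dimension \<open>d\<close> has \<open>q ^ d\<close> elements, so all dimensions below
are read off from cardinalities.

Reading the rows from bottom to top, a Toeplitz matrix becomes a Hankel matrix
\<open>(\<tau> (i + j))\<close>. Identify a vector with a polynomial \<open>p\<close> of bounded degree, and let \<open>\<tau>\<close> also denote
the linear functional that sends \<open>X ^ j\<close> to \<open>\<tau> j\<close>; then \<open>p\<close> lies in the kernel exactly if \<open>\<tau>\<close> vanishes on
\<open>X ^ i * p\<close> for every row index \<open>i\<close>. Let \<open>V\<close> be the space of polynomials of degree at most
\<open>n + 1\<close> that are annihilated by the \<open>n\<close> middle rows of \<open>\<A>\<^sub>n\<^sub>+\<^sub>1\<close>. These rows do not involve the two new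
corner entries \<open>x = a\<^sub>n\<^sub>+\<^sub>1\<close> and \<open>y = b\<^sub>n\<^sub>+\<^sub>1\<close>. On \<open>V\<close> there are four functionals: the lowest and
the highest coefficient \<open>\<alpha>\<close> and \<open>\<beta>\<close>, and the first and last rows \<open>f\<close> and \<open>g\<close> without the corner
entries. Every kernel in question is cut out of \<open>V\<close> by them:
\<open>ker \<A>\<^sub>n = {f = \<beta> = 0}\<close>, its multiple \<open>X \<cdot> ker \<A>\<^sub>n = {g = \<alpha> = 0}\<close>,
\<open>X \<cdot> ker \<A>\<^sub>n\<^sub>-\<^sub>1 = {\<alpha> = \<beta> = 0}\<close>, and
\<open>ker \<A>\<^sub>n\<^sub>+\<^sub>1 = {f + x * \<beta> = 0, g + y * \<alpha> = 0}\<close>.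

The size of \<open>V\<close> comes from a duality. The \<open>r \<times> m\<close> and the \<open>m \<times> r\<close> Hankel matrices of one sequence
are transposes of each other and hence have equal rank
(\<open>card_annihilated_swap\<close>, by double counting); this gives
\<open>|V| = q\<^sup>2 * |ker \<A>\<^sub>n \<inter> X \<cdot> ker \<A>\<^sub>n|\<close>.

Suppose \<open>\<A>\<^sub>n\<close> is singular. A nonzero space of polynomials of bounded degree is not stable under
multiplication by \<open>X\<close>, so \<open>ker \<A>\<^sub>n\<close> and \<open>X \<cdot> ker \<A>\<^sub>n\<close> differ, and the duality forces both to be
hyperplanes of \<open>V\<close> (\<open>card_ambient_singular\<close>). Hence \<open>f\<close> and \<open>\<beta>\<close> are multiples of one functional
\<open>\<phi>\<close>, and \<open>g\<close> and \<open>\<alpha>\<close> are multiples of one functional \<open>\<psi>\<close> that is independent of \<open>\<phi>\<close>. The nullity of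
\<open>\<A>\<^sub>n\<^sub>+\<^sub>1\<close> then depends only on which of the two affine functions \<open>f\<^sub>0 + x * \<beta>\<^sub>0\<close> and
\<open>g\<^sub>0 + y * \<alpha>\<^sub>0\<close> vanish, and the nullity of \<open>\<A>\<^sub>n\<^sub>-\<^sub>1\<close> tells which of \<open>\<alpha>\<^sub>0\<close> and \<open>\<beta>\<^sub>0\<close> are zero
(\<open>pencil_count_singular\<close>).

If \<open>\<A>\<^sub>n\<close> is regular, then \<open>V\<close> is a plane, and \<open>\<A>\<^sub>n\<^sub>+\<^sub>1\<close> is singular exactly if a \<open>2 \<times> 2\<close> determinant
vanishes. This is the equation of a hyperbola \<open>(b + x) * (c + y) = s\<close> with \<open>s \<noteq> 0\<close> if \<open>\<A>\<^sub>n\<^sub>-\<^sub>1\<close> is regular,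
and the equation of a line if \<open>\<A>\<^sub>n\<^sub>-\<^sub>1\<close> has nullity one (\<open>pencil_count_plane\<close>).\<close>

section \<open>Linear functionals on spaces over a finite field\<close>

locale finite_field_space = vector_space scale
  for scale :: "'a::{field,finite} \<Rightarrow> 'b::ab_group_add \<Rightarrow> 'b" (infixr "*s" 75)
begin

abbreviation functional :: "('b \<Rightarrow> 'a) \<Rightarrow> bool" where
  "functional f \<equiv> Vector_Spaces.linear scale (*) f"

lemma functionalI:
  assumes "\<And>u v. f (u + v) = f u + f v" "\<And>c v. f (c *s v) = c * f v"
  shows "functional f"
proof -
  have "vector_space ((*) :: 'a \<Rightarrow> 'a \<Rightarrow> 'a)"
    by unfold_locales (auto simp: algebra_simps)
  then show ?thesis
    unfolding Vector_Spaces.linear_iff using assms vector_space_axioms by blast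
qed

lemma functional_add: "functional f \<Longrightarrow> f (u + v) = f u + f v"
  and functional_scale: "functional f \<Longrightarrow> f (c *s v) = c * f v"
  by (simp_all add: Vector_Spaces.linear_iff)

lemma functional_0: "functional f \<Longrightarrow> f 0 = 0"
  using functional_scale[of f 0 0] by simp

lemma functional_diff: "functional f \<Longrightarrow> f (u - v) = f u - f v"
  using functional_add[of f "u - v" v] by simp

lemmas functional_simps = functional_add functional_scale functional_0 functional_diff

lemma subspace_functional_zero:
  assumes "subspace V" "functional f"
  shows "subspace {v \<in> V. f v = 0}"
  using assms by (auto simp: subspace_def functional_simps)

lemma functional_normalize:
  assumes "subspace V" "functional f" "v \<in> V" "f v \<noteq> 0"
  obtains u where "u \<in> V" "f u = 1"
proof
  show "(inverse (f v)) *s v \<in> V" using assms subspace_scale by blast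
  show "f ((inverse (f v)) *s v) = 1" using assms by (simp add: functional_simps)
qed

text \<open>A nonzero functional identifies the space with the product of its kernel and the field.\<close>

lemma card_functional_zero:
  assumes V: "subspace V" "finite V" and f: "functional f" and v: "v \<in> V" "f v \<noteq> 0"
  shows "card V = CARD('a) * card {v \<in> V. f v = 0}"
proof -
  obtain u where u: "u \<in> V" "f u = 1"
    using functional_normalize[OF V(1) f v] .
  have in_V: "w + c *s u \<in> V" "w - c *s u \<in> V" if "w \<in> V" for c w
    using V(1) u(1) that by (simp_all add: subspace_add subspace_diff subspace_scale)
  have f_u: "f (w + c *s u) = f w + c" "f (w - c *s u) = f w - c" for c w
    using f u(2) by (simp_all add: functional_simps)
  have "bij_betw (\<lambda>(c, w). w + c *s u) (UNIV \<times> {v \<in> V. f v = 0}) V"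
    by (rule bij_betwI[where g = "\<lambda>w. (f w, w - f w *s u)"]) (auto simp: in_V f_u)
  from bij_betw_same_card[OF this] show ?thesis
    by (simp only: card_cartesian_product)
qed

lemma functional_multiple:
  assumes V: "subspace V" and f: "functional f" "functional h" and v: "v \<in> V" "f v \<noteq> 0"
    and ker: "\<And>w. w \<in> V \<Longrightarrow> f w = 0 \<Longrightarrow> h w = 0"
  obtains c where "\<And>w. w \<in> V \<Longrightarrow> h w = c * f w"
proof -
  obtain u where u: "u \<in> V" "f u = 1"
    using functional_normalize[OF V f(1) v] .
  have "h w = h u * f w" if "w \<in> V" for w
  proof -
    have "h (w - f w *s u) = 0"
      using that u f V by (intro ker) (auto simp: functional_simps subspace_diff subspace_scale)
    then show ?thesis using f by (simp add: functional_simps)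
  qed
  then show thesis by (rule that)
qed

lemma card_ge_2: "CARD('a) \<ge> 2"
proof -
  have "card {0, 1::'a} \<le> CARD('a)" by (intro card_mono) auto
  then show ?thesis by simp
qed

lemma subspace_card_pos: "subspace V \<Longrightarrow> finite V \<Longrightarrow> card V > 0"
  using subspace_0 card_gt_0_iff by blast

text \<open>Two functionals whose common kernel is a hyperplane are proportional: the kernel of a nonzero one
contains that hyperplane and has the same size, so the other one vanishes there too.\<close>

lemma hyperplane_functional:
  assumes V: "subspace V" "finite V" and f: "functional f" "functional h"
    and hyp: "card V = CARD('a) * card {v \<in> V. f v = 0 \<and> h v = 0}"
  obtains \<phi> a b v where "functional \<phi>" "a \<noteq> 0 \<or> b \<noteq> 0" "v \<in> V" "\<phi> v \<noteq> 0"
    "\<forall>v\<in>V. f v = a * \<phi> v \<and> h v = b * \<phi> v"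
proof -
  have key: "\<exists>c. \<forall>w\<in>V. h w = c * f w"
    if f: "functional f" "functional h" and v: "v \<in> V" "f v \<noteq> 0"
      and hyp: "card V = CARD('a) * card {v \<in> V. f v = 0 \<and> h v = 0}" for f h v
  proof -
    have "card {v \<in> V. f v = 0} = card {v \<in> V. f v = 0 \<and> h v = 0}"
      using card_functional_zero[OF V f(1) v] hyp by simp
    then have "{v \<in> V. f v = 0 \<and> h v = 0} = {v \<in> V. f v = 0}"
      using V(2) by (intro card_subset_eq) auto
    then have "\<And>w. w \<in> V \<Longrightarrow> f w = 0 \<Longrightarrow> h w = 0" by blast
    then obtain c where "\<And>w. w \<in> V \<Longrightarrow> h w = c * f w"
      using functional_multiple[OF V(1) f v] by metis
    then show ?thesis by blast
  qed
  have "\<exists>v\<in>V. f v \<noteq> 0 \<or> h v \<noteq> 0"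
  proof (rule ccontr)
    assume "\<not> ?thesis"
    then have "{v \<in> V. f v = 0 \<and> h v = 0} = V" by blast
    then have "1 * card V = CARD('a) * card V" using hyp by (metis mult_1)
    then have "CARD('a) = 1"
      using subspace_card_pos[OF V] unfolding mult_cancel2 by linarith
    then show False using card_ge_2 by linarith
  qed
  then obtain v where v: "v \<in> V" "f v \<noteq> 0 \<or> h v \<noteq> 0" by blast
  show thesis
  proof (cases "f v = 0")
    case False
    from key[OF f v(1) False hyp] obtain c where "\<forall>w\<in>V. h w = c * f w" by blast
    then show thesis by (intro that[OF f(1) _ v(1) False, of 1 c]) simp_all
  next
    case True
    then have "h v \<noteq> 0" using v by blast
    have hyp': "card V = CARD('a) * card {v \<in> V. h v = 0 \<and> f v = 0}"
      by (subst hyp) (simp only: conj_commute)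
    from key[OF f(2,1) v(1) \<open>h v \<noteq> 0\<close> hyp'] obtain c where "\<forall>w\<in>V. f w = c * h w"
      by blast
    then show thesis
      by (intro that[OF f(2) _ v(1) \<open>h v \<noteq> 0\<close>, of c 1]) simp_all
  qed
qed

text \<open>Functionals with different kernels are independent, so each condition that is not void divides the
number of solutions by the size of the field.\<close>

lemma card_zero_two_functionals:
  assumes V: "subspace V" "finite V" and card: "card V = CARD('a) ^ Suc (Suc k)"
    and \<phi>: "functional \<phi>" "u \<in> V" "\<phi> u \<noteq> 0"
    and \<psi>: "functional \<psi>" "w \<in> V" "\<psi> w \<noteq> 0"
    and neq: "{v \<in> V. \<phi> v = 0} \<noteq> {v \<in> V. \<psi> v = 0}"
  shows "card {v \<in> V. a * \<phi> v = 0 \<and> b * \<psi> v = 0}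
    = CARD('a) ^ (Suc (Suc k) - of_bool (a \<noteq> 0) - of_bool (b \<noteq> 0))"
proof -
  note c\<phi> = card_functional_zero[OF V \<phi>] and c\<psi> = card_functional_zero[OF V \<psi>]
  have "\<exists>z\<in>{v \<in> V. \<phi> v = 0}. \<psi> z \<noteq> 0"
  proof (rule ccontr)
    assume "\<not> ?thesis"
    then have "{v \<in> V. \<phi> v = 0} \<subseteq> {v \<in> V. \<psi> v = 0}" by blast
    moreover have "card {v \<in> V. \<phi> v = 0} = card {v \<in> V. \<psi> v = 0}"
      using c\<phi> c\<psi> by simp
    ultimately show False using neq V(2) card_subset_eq[of "{v \<in> V. \<psi> v = 0}"] by simp
  qed
  then obtain z where z: "z \<in> {v \<in> V. \<phi> v = 0}" "\<psi> z \<noteq> 0" by blast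
  have L: "subspace {v \<in> V. \<phi> v = 0}" "finite {v \<in> V. \<phi> v = 0}"
    using V \<phi>(1) subspace_functional_zero by auto
  have "{v \<in> {v \<in> V. \<phi> v = 0}. \<psi> v = 0} = {v \<in> V. \<phi> v = 0 \<and> \<psi> v = 0}" by blast
  then have "card {v \<in> V. \<phi> v = 0} = CARD('a) * card {v \<in> V. \<phi> v = 0 \<and> \<psi> v = 0}"
    using card_functional_zero[OF L \<psi>(1) z] by (simp only:)
  moreover have "card {v \<in> V. \<phi> v = 0} = CARD('a) ^ Suc k" "card {v \<in> V. \<psi> v = 0} = CARD('a) ^ Suc k"
    using c\<phi> c\<psi> unfolding card by simp_all
  ultimately show ?thesis
    using card by (cases "a = 0"; cases "b = 0") simp_all
qed

lemma plane_nonzero_on_line: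
  assumes V: "subspace V" "finite V" and card: "card V = CARD('a)\<^sup>2"
    and h: "functional h1" "functional h2"
    and inj: "\<And>v. v \<in> V \<Longrightarrow> h1 v = 0 \<Longrightarrow> h2 v = 0 \<Longrightarrow> v = 0"
  obtains v where "v \<in> V" "h1 v = 0" "h2 v = 1"
proof -
  let ?L = "{v \<in> V. h1 v = 0}"
  have L: "subspace ?L" "finite ?L" using V h subspace_functional_zero by auto
  have "card V \<le> CARD('a) * card ?L"
  proof (cases "\<exists>v\<in>V. h1 v \<noteq> 0")
    case True
    then show ?thesis using card_functional_zero[OF V h(1)] by auto
  next
    case False
    then have "?L = V" by blast
    then show ?thesis using card_ge_2 by simp
  qed
  then have "CARD('a) \<le> card ?L" using card card_ge_2 by (simp add: power2_eq_square)
  moreover have "card {0::'b} = 1" by simp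
  ultimately have "\<not> ?L \<subseteq> {0}" using card_ge_2 card_mono[of "{0::'b}" ?L] by auto
  then obtain z where z: "z \<in> ?L" "h2 z \<noteq> 0" using inj by blast
  obtain v where "v \<in> ?L" "h2 v = 1"
    using functional_normalize[OF L(1) h(2) z] .
  then show thesis using that by blast
qed

text \<open>An injective pair of functionals on a space of \<open>q\<^sup>2\<close> elements is a coordinate system: \<open>v1\<close> and
\<open>v2\<close> are the basis dual to it.\<close>

lemma plane_coordinates:
  assumes V: "subspace V" "finite V" and card: "card V = CARD('a)\<^sup>2"
    and h: "functional h1" "functional h2"
    and inj: "\<And>v. v \<in> V \<Longrightarrow> h1 v = 0 \<Longrightarrow> h2 v = 0 \<Longrightarrow> v = 0"
  obtains v1 v2 where "v1 \<in> V" "h1 v1 = 1" "h2 v1 = 0" "v2 \<in> V" "h1 v2 = 0" "h2 v2 = 1"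
    "\<forall>f. functional f \<longrightarrow> (\<forall>v\<in>V. f v = f v1 * h1 v + f v2 * h2 v)"
proof -
  obtain v2 where v2: "v2 \<in> V" "h1 v2 = 0" "h2 v2 = 1"
    using plane_nonzero_on_line[OF V card h inj] .
  obtain v1 where v1: "v1 \<in> V" "h2 v1 = 0" "h1 v1 = 1"
    using plane_nonzero_on_line[OF V card h(2,1) inj] .
  have "f v = f v1 * h1 v + f v2 * h2 v" if f: "functional f" and v: "v \<in> V" for f v
  proof -
    have "v - h1 v *s v1 - h2 v *s v2 = 0"
      using V v v1 v2 h by (intro inj) (auto simp: functional_simps subspace_diff subspace_scale)
    then have "f (v - h1 v *s v1 - h2 v *s v2) = 0" using f by (simp add: functional_simps)
    then show ?thesis using f by (simp add: functional_simps algebra_simps)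
  qed
  then show thesis using that[OF v1(1,3,2) v2] by blast
qed

text \<open>The kernel of a nonzero \<open>2 \<times> 2\<close> matrix, with rows \<open>(a, b)\<close> and \<open>(c, d)\<close> in the coordinates
\<open>h1\<close> and \<open>h2\<close>, is a line or trivial according to its determinant.\<close>

lemma card_plane_pencil:
  assumes V: "subspace V" "finite V" and card: "card V = CARD('a)\<^sup>2"
    and h: "functional h1" "functional h2"
    and inj: "\<And>v. v \<in> V \<Longrightarrow> h1 v = 0 \<Longrightarrow> h2 v = 0 \<Longrightarrow> v = 0"
    and ab: "a \<noteq> 0 \<or> b \<noteq> 0"
  shows "card {v \<in> V. a * h1 v + b * h2 v = 0 \<and> c * h1 v + d * h2 v = 0}
    = (if a * d = b * c then CARD('a) else 1)"
proof -
  let ?F = "\<lambda>v. a * h1 v + b * h2 v" and ?G = "\<lambda>v. c * h1 v + d * h2 v"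
  have F: "functional ?F" and G: "functional ?G"
    using h by (auto intro!: functionalI simp: functional_simps algebra_simps)
  obtain v1 v2 where v: "v1 \<in> V" "h1 v1 = 1" "h2 v1 = 0" "v2 \<in> V" "h1 v2 = 0" "h2 v2 = 1"
    by (rule plane_coordinates[OF V card h inj])
  let ?L = "{v \<in> V. ?F v = 0}"
  have L: "subspace ?L" "finite ?L" using V subspace_functional_zero[OF V(1) F] by auto
  have "?F v1 \<noteq> 0 \<or> ?F v2 \<noteq> 0" using ab v by simp
  then obtain w where w: "w \<in> V" "?F w \<noteq> 0" using v(1,4) by blast
  have "CARD('a) * CARD('a) = CARD('a) * card ?L"
    using card_functional_zero[OF V F w] unfolding card power2_eq_square .
  then have cL: "card ?L = CARD('a)" using card_ge_2 by simp
  have int: "{v \<in> ?L. ?G v = 0} = {v \<in> V. ?F v = 0 \<and> ?G v = 0}" by blast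
  show ?thesis
  proof (cases "a * d = b * c")
    case True
    have "?G w = 0" if "?F w = 0" for w
    proof -
      have "a * ?G w = c * ?F w + (a * d - b * c) * h2 w"
        "b * ?G w = d * ?F w - (a * d - b * c) * h1 w"
        by (simp_all add: algebra_simps)
      then have "a * ?G w = 0" "b * ?G w = 0"
        unfolding that True by simp_all
      then show ?thesis using ab unfolding mult_eq_0_iff by blast
    qed
    then have "{v \<in> V. ?F v = 0 \<and> ?G v = 0} = ?L" by blast
    then show ?thesis using cL True by simp
  next
    case False
    \<comment> \<open>This vector spans the line where \<open>?F\<close> vanishes, and \<open>?G\<close> takes the value \<open>b * c - a * d\<close> on it.\<close>
    let ?u = "b *s v1 - a *s v2"
    have "?u \<in> V" "?F ?u = 0" "?G ?u \<noteq> 0"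
      using V v h False by (auto simp: functional_simps subspace_diff subspace_scale algebra_simps)
    then have "card ?L = CARD('a) * card {v \<in> ?L. ?G v = 0}"
      using L G by (intro card_functional_zero[of _ ?G ?u]) auto
    then show ?thesis using cL int False by simp
  qed
qed

end

section \<open>Counting zeros of pencils of functionals\<close>

lemma card_affine_zero:
  fixes a b :: "'a::{field,finite}"
  assumes "a \<noteq> 0 \<or> b \<noteq> 0"
  shows "card {x. a + x * b = 0} = of_bool (b \<noteq> 0)"
proof (cases "b = 0")
  case False
  then have "{x. a + x * b = 0} = {- a / b}" by (auto simp: field_simps eq_neg_iff_add_eq_0)
  then show ?thesis using False by simp
qed (use assms in simp)

text \<open>The hyperbola is parametrized by its first factor, which ranges over the nonzero field elements.\<close>

lemma card_hyperbola:
  fixes b c s :: "'a::{field,finite}"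
  assumes "s \<noteq> 0"
  shows "card {(x, y). s = (b + x) * (c + y)} = CARD('a) - 1"
proof -
  have "bij_betw (\<lambda>t. (t - b, s / t - c)) (- {0}) {(x, y). s = (b + x) * (c + y)}"
  proof (rule bij_betwI[where g = "\<lambda>(x, y). b + x"])
    show "(\<lambda>(x, y). b + x) \<in> {(x, y). s = (b + x) * (c + y)} \<rightarrow> - {0}"
      using assms by auto
    show "(\<lambda>t. (t - b, s / t - c)) (case p of (x, y) \<Rightarrow> b + x) = p"
      if "p \<in> {(x, y). s = (b + x) * (c + y)}" for p
      using that assms by auto
  qed auto
  from bij_betw_same_card[OF this] show ?thesis by (simp add: Compl_eq_Diff_UNIV)
qed

lemma card_line:
  fixes c d l :: "'a::{field,finite}"
  assumes "d \<noteq> 0"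
  shows "card {(x, y). x * d = c + y * l} = CARD('a)"
proof -
  have "bij_betw (\<lambda>y. ((c + y * l) / d, y)) UNIV {(x, y). x * d = c + y * l}"
    by (rule bij_betwI[where g = snd]) (use assms in \<open>auto simp: field_simps\<close>)
  from bij_betw_same_card[OF this] show ?thesis by simp
qed

context finite_field_space
begin

lemma power_card_inject: "CARD('a) ^ m = CARD('a) ^ n \<longleftrightarrow> m = n"
  using card_ge_2 by (simp add: power_inject_exp)

text \<open>In this and the following lemmas, \<open>\<alpha>\<close>, \<open>\<beta>\<close>, \<open>f\<close>, \<open>g\<close> are arbitrary functionals with the incidences that
the Toeplitz matrices produce. Both pairs \<open>f\<close>, \<open>\<beta>\<close> and \<open>g\<close>, \<open>\<alpha>\<close> consist of multiples of a
single functional, with the coefficients \<open>f0\<close>, \<open>b0\<close> and \<open>g0\<close>, \<open>a0\<close>; so the two conditions of the pencil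
become independent of each other, and \<open>x\<close> and \<open>y\<close> decouple.\<close>

lemma pencil_singular:
  assumes V: "subspace V" "finite V" and card: "card V = CARD('a) ^ Suc (Suc k)"
    and func: "functional \<alpha>" "functional \<beta>" "functional f" "functional g"
    and K: "card {v \<in> V. f v = 0 \<and> \<beta> v = 0} = CARD('a) ^ Suc k"
    and L: "card {v \<in> V. g v = 0 \<and> \<alpha> v = 0} = CARD('a) ^ Suc k"
    and neq: "{v \<in> V. f v = 0 \<and> \<beta> v = 0} \<noteq> {v \<in> V. g v = 0 \<and> \<alpha> v = 0}"
  obtains f0 b0 g0 a0 where "f0 \<noteq> 0 \<or> b0 \<noteq> 0" "g0 \<noteq> 0 \<or> a0 \<noteq> 0"
    "card {v \<in> V. \<beta> v = 0 \<and> \<alpha> v = 0}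
      = CARD('a) ^ (Suc (Suc k) - of_bool (b0 \<noteq> 0) - of_bool (a0 \<noteq> 0))"
    "\<forall>x y. card {v \<in> V. f v + x * \<beta> v = 0 \<and> g v + y * \<alpha> v = 0}
      = CARD('a) ^ (Suc (Suc k) - of_bool (f0 + x * b0 \<noteq> 0) - of_bool (g0 + y * a0 \<noteq> 0))"
proof -
  have hK: "card V = CARD('a) * card {v \<in> V. f v = 0 \<and> \<beta> v = 0}"
    unfolding card K by simp
  have hL: "card V = CARD('a) * card {v \<in> V. g v = 0 \<and> \<alpha> v = 0}"
    unfolding card L by simp
  obtain \<phi> f0 b0 u where \<phi>: "functional \<phi>" "f0 \<noteq> 0 \<or> b0 \<noteq> 0" "u \<in> V" "\<phi> u \<noteq> 0"
    and fb: "\<forall>v\<in>V. f v = f0 * \<phi> v \<and> \<beta> v = b0 * \<phi> v"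
    by (rule hyperplane_functional[OF V func(3,2) hK])
  obtain \<psi> g0 a0 w where \<psi>: "functional \<psi>" "g0 \<noteq> 0 \<or> a0 \<noteq> 0" "w \<in> V" "\<psi> w \<noteq> 0"
    and ga: "\<forall>v\<in>V. g v = g0 * \<psi> v \<and> \<alpha> v = a0 * \<psi> v"
    by (rule hyperplane_functional[OF V func(4,1) hL])
  have "{v \<in> V. f v = 0 \<and> \<beta> v = 0} = {v \<in> V. \<phi> v = 0}"
    using \<phi>(2) by (auto simp: fb)
  moreover have "{v \<in> V. g v = 0 \<and> \<alpha> v = 0} = {v \<in> V. \<psi> v = 0}"
    using \<psi>(2) by (auto simp: ga)
  ultimately have "{v \<in> V. \<phi> v = 0} \<noteq> {v \<in> V. \<psi> v = 0}"
    using neq by simp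
  note count = card_zero_two_functionals[OF V card \<phi>(1,3,4) \<psi>(1,3,4) this]
  have "{v \<in> V. \<beta> v = 0 \<and> \<alpha> v = 0} = {v \<in> V. b0 * \<phi> v = 0 \<and> a0 * \<psi> v = 0}"
    using fb ga by auto
  moreover have "{v \<in> V. f v + x * \<beta> v = 0 \<and> g v + y * \<alpha> v = 0}
      = {v \<in> V. (f0 + x * b0) * \<phi> v = 0 \<and> (g0 + y * a0) * \<psi> v = 0}" for x y
    using fb ga by (auto simp: algebra_simps)
  ultimately show thesis
    by (intro that[OF \<phi>(2) \<psi>(2)] allI) (simp_all only: count)
qed

text \<open>Here \<open>\<alpha>\<close> and \<open>\<beta>\<close> are coordinates on \<open>V\<close>. The product \<open>s\<close> of the diagonal entries of the
pencil matrix is nonzero, because \<open>f\<close> cannot vanish on the line \<open>\<beta> = 0\<close>, nor \<open>g\<close> on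
the line \<open>\<alpha> = 0\<close>.\<close>

lemma pencil_plane_regular:
  assumes V: "subspace V" "finite V" and card: "card V = CARD('a)\<^sup>2"
    and func: "functional \<alpha>" "functional \<beta>" "functional f" "functional g"
    and K: "\<And>v. v \<in> V \<Longrightarrow> f v = 0 \<Longrightarrow> \<beta> v = 0 \<Longrightarrow> v = 0"
    and L: "\<And>v. v \<in> V \<Longrightarrow> g v = 0 \<Longrightarrow> \<alpha> v = 0 \<Longrightarrow> v = 0"
    and B: "\<And>v. v \<in> V \<Longrightarrow> \<alpha> v = 0 \<Longrightarrow> \<beta> v = 0 \<Longrightarrow> v = 0"
  obtains s b c where "s \<noteq> 0"
    "\<forall>x y. card {v \<in> V. f v + x * \<beta> v = 0 \<and> g v + y * \<alpha> v = 0}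
      = (if s = (b + x) * (c + y) then CARD('a) else 1)"
proof -
  obtain v1 v2 where v: "v1 \<in> V" "\<alpha> v1 = 1" "\<beta> v1 = 0" "v2 \<in> V" "\<alpha> v2 = 0" "\<beta> v2 = 1"
    and exp: "\<forall>h. functional h \<longrightarrow> (\<forall>v\<in>V. h v = h v1 * \<alpha> v + h v2 * \<beta> v)"
    by (rule plane_coordinates[OF V card func(1,2) B])
  have a: "f v1 \<noteq> 0"
  proof
    assume "f v1 = 0"
    then have "v1 = 0" using K v by blast
    then show False using v(2) func(1) by (simp add: functional_0)
  qed
  have d: "g v2 \<noteq> 0"
  proof
    assume "g v2 = 0"
    then have "v2 = 0" using L v by blast
    then show False using v(6) func(2) by (simp add: functional_0)
  qed
  have "card {v \<in> V. f v + x * \<beta> v = 0 \<and> g v + y * \<alpha> v = 0}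
      = (if f v1 * g v2 = (f v2 + x) * (g v1 + y) then CARD('a) else 1)" for x y
  proof -
    have "{v \<in> V. f v + x * \<beta> v = 0 \<and> g v + y * \<alpha> v = 0}
      = {v \<in> V. f v1 * \<alpha> v + (f v2 + x) * \<beta> v = 0 \<and> (g v1 + y) * \<alpha> v + g v2 * \<beta> v = 0}"
    proof (intro Collect_cong conj_cong refl)
      fix v assume "v \<in> V"
      then have "f v = f v1 * \<alpha> v + f v2 * \<beta> v" "g v = g v1 * \<alpha> v + g v2 * \<beta> v"
        using exp func(3,4) by blast+
      then have "f v + x * \<beta> v = f v1 * \<alpha> v + (f v2 + x) * \<beta> v"
        "g v + y * \<alpha> v = (g v1 + y) * \<alpha> v + g v2 * \<beta> v"
        by (simp_all only: distrib_right add_ac)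
      then show "f v + x * \<beta> v = 0 \<longleftrightarrow> f v1 * \<alpha> v + (f v2 + x) * \<beta> v = 0"
        "g v + y * \<alpha> v = 0 \<longleftrightarrow> (g v1 + y) * \<alpha> v + g v2 * \<beta> v = 0"
        by simp_all
    qed
    from arg_cong[OF this, of card] show ?thesis
      by (rule trans) (rule card_plane_pencil[OF V card func(1,2)]; use B a in blast)
  qed
  then show thesis
    using a d by (intro that[of "f v1 * g v2" "f v2" "g v1"] allI) simp_all
qed

text \<open>When \<open>\<alpha>\<close> and \<open>\<beta>\<close> both vanish at some \<open>z \<noteq> 0\<close>, they are no longer coordinates, but \<open>f\<close> and \<open>\<beta>\<close> are. Then
\<open>\<alpha>\<close> is a multiple of \<open>\<beta>\<close>, with factor \<open>l\<close>, so the determinant is affine in \<open>x\<close> and \<open>y\<close>.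
The coefficient \<open>d\<close> of \<open>x\<close> is nonzero, as otherwise \<open>g\<close> and \<open>\<alpha>\<close> would both vanish at \<open>v1\<close>.\<close>

lemma pencil_plane_singular:
  assumes V: "subspace V" "finite V" and card: "card V = CARD('a)\<^sup>2"
    and func: "functional \<alpha>" "functional \<beta>" "functional f" "functional g"
    and K: "\<And>v. v \<in> V \<Longrightarrow> f v = 0 \<Longrightarrow> \<beta> v = 0 \<Longrightarrow> v = 0"
    and L: "\<And>v. v \<in> V \<Longrightarrow> g v = 0 \<Longrightarrow> \<alpha> v = 0 \<Longrightarrow> v = 0"
    and B: "z \<in> V" "z \<noteq> 0" "\<alpha> z = 0" "\<beta> z = 0"
  obtains c d l where "d \<noteq> 0"
    "\<forall>x y. card {v \<in> V. f v + x * \<beta> v = 0 \<and> g v + y * \<alpha> v = 0}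
      = (if x * d = c + y * l then CARD('a) else 1)"
proof -
  obtain v1 v2 where v: "v1 \<in> V" "f v1 = 1" "\<beta> v1 = 0" "v2 \<in> V" "f v2 = 0" "\<beta> v2 = 1"
    and exp: "\<forall>h. functional h \<longrightarrow> (\<forall>v\<in>V. h v = h v1 * f v + h v2 * \<beta> v)"
    by (rule plane_coordinates[OF V card func(3,2) K])
  have "f z \<noteq> 0" using K B by blast
  \<comment> \<open>The common zero shows that \<open>\<alpha>\<close> has no \<open>f\<close> component.\<close>
  moreover have "\<alpha> v1 * f z = 0" using exp func(1) B by force
  ultimately have \<alpha>1: "\<alpha> v1 = 0" by simp
  have d: "g v1 \<noteq> 0"
  proof
    assume "g v1 = 0"
    then have "v1 = 0" using L v \<alpha>1 by blast
    then show False using v(2) func(3) by (simp add: functional_0)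
  qed
  have "card {v \<in> V. f v + x * \<beta> v = 0 \<and> g v + y * \<alpha> v = 0}
      = (if x * g v1 = g v2 + y * \<alpha> v2 then CARD('a) else 1)" for x y
  proof -
    have "card {v \<in> V. f v + x * \<beta> v = 0 \<and> g v + y * \<alpha> v = 0}
      = card {v \<in> V. 1 * f v + x * \<beta> v = 0 \<and> g v1 * f v + (g v2 + y * \<alpha> v2) * \<beta> v = 0}"
    proof (intro arg_cong[where f = card] Collect_cong conj_cong refl)
      fix v assume "v \<in> V"
      then have "g v = g v1 * f v + g v2 * \<beta> v" "\<alpha> v = \<alpha> v2 * \<beta> v"
        using exp func(1,4) \<alpha>1 by (blast, force)
      then have "g v + y * \<alpha> v = g v1 * f v + (g v2 + y * \<alpha> v2) * \<beta> v"
        by (simp add: algebra_simps)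
      then show "g v + y * \<alpha> v = 0 \<longleftrightarrow> g v1 * f v + (g v2 + y * \<alpha> v2) * \<beta> v = 0"
        by simp
    qed simp
    also have "\<dots>
        = (if 1 * (g v2 + y * \<alpha> v2) = x * g v1 then CARD('a) else 1)"
      by (rule card_plane_pencil[OF V card func(3,2)]) (use K in blast, simp)
    finally show ?thesis by (simp add: eq_commute[of "x * g v1"])
  qed
  then show thesis by (intro that[OF d] allI)
qed

text \<open>The exponent drops from \<open>k + 2\<close> by one for each of the two affine functions \<open>f0 + x * b0\<close> and
\<open>g0 + y * a0\<close> that does not vanish. Its zero set is a single point or empty, according to whether \<open>b0\<close>,
respectively \<open>a0\<close>, is nonzero, and \<open>m\<close> tells how many of \<open>b0\<close> and \<open>a0\<close> are nonzero. The counts are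
symmetric in the two.\<close>

lemma pencil_count_singular:
  fixes \<alpha> \<beta> f g :: "'b \<Rightarrow> 'a"
  assumes V: "subspace V" "finite V" and card: "card V = CARD('a) ^ Suc (Suc k)"
    and func: "functional \<alpha>" "functional \<beta>" "functional f" "functional g"
    and K: "card {v \<in> V. f v = 0 \<and> \<beta> v = 0} = CARD('a) ^ Suc k"
    and L: "card {v \<in> V. g v = 0 \<and> \<alpha> v = 0} = CARD('a) ^ Suc k"
    and neq: "{v \<in> V. f v = 0 \<and> \<beta> v = 0} \<noteq> {v \<in> V. g v = 0 \<and> \<alpha> v = 0}"
    and m: "card {v \<in> V. \<beta> v = 0 \<and> \<alpha> v = 0} = CARD('a) ^ m"
  defines "M \<equiv> \<lambda>c. card {(x, y). card {v \<in> V. f v + x * \<beta> v = 0 \<and> g v + y * \<alpha> v = 0} = CARD('a) ^ c}"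
  shows "m = k \<Longrightarrow> M (Suc (Suc k)) = 1"
    and "m = k \<Longrightarrow> M (Suc k) = 2 * CARD('a) - 2"
    and "m = k \<Longrightarrow> M k = (CARD('a) - 1)\<^sup>2"
    and "m = Suc k \<Longrightarrow> M (Suc k) = CARD('a)"
    and "m = Suc k \<Longrightarrow> M k = (CARD('a))\<^sup>2 - CARD('a)"
    and "m = Suc (Suc k) \<Longrightarrow> M k = (CARD('a))\<^sup>2"
proof -
  obtain f0 b0 g0 a0 where nz: "f0 \<noteq> 0 \<or> b0 \<noteq> 0" "g0 \<noteq> 0 \<or> a0 \<noteq> 0"
    and B: "card {v \<in> V. \<beta> v = 0 \<and> \<alpha> v = 0}
      = CARD('a) ^ (Suc (Suc k) - of_bool (b0 \<noteq> 0) - of_bool (a0 \<noteq> 0))"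
    and N: "\<forall>x y. card {v \<in> V. f v + x * \<beta> v = 0 \<and> g v + y * \<alpha> v = 0}
      = CARD('a) ^ (Suc (Suc k) - of_bool (f0 + x * b0 \<noteq> 0) - of_bool (g0 + y * a0 \<noteq> 0))"
    by (rule pencil_singular[OF V card func K L neq])
  define X where "X = {x. f0 + x * b0 = 0}"
  define Y where "Y = {y. g0 + y * a0 = 0}"
  have X: "card X = of_bool (b0 \<noteq> 0)" "card (- X) = CARD('a) - of_bool (b0 \<noteq> 0)"
    using card_affine_zero[OF nz(1)]
    by (simp_all add: X_def Compl_eq_Diff_UNIV card_Diff_subset)
  have Y: "card Y = of_bool (a0 \<noteq> 0)" "card (- Y) = CARD('a) - of_bool (a0 \<noteq> 0)"
    using card_affine_zero[OF nz(2)]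
    by (simp_all add: Y_def Compl_eq_Diff_UNIV card_Diff_subset)
  have exp: "m = Suc (Suc k) - of_bool (b0 \<noteq> 0) - of_bool (a0 \<noteq> 0)"
    using B unfolding m power_card_inject .
  have M: "M c = card {(x, y). Suc (Suc k) - of_bool (x \<notin> X) - of_bool (y \<notin> Y) = c}" for c
    unfolding M_def X_def Y_def by (simp only: N power_card_inject mem_Collect_eq)
  have "{(x, y). Suc (Suc k) - of_bool (x \<notin> X) - of_bool (y \<notin> Y) = Suc (Suc k)} = X \<times> Y"
    by (auto simp: of_bool_def split: if_splits)
  then have M2: "M (Suc (Suc k)) = card X * card Y"
    unfolding M by (simp only: card_cartesian_product)
  have "{(x, y). Suc (Suc k) - of_bool (x \<notin> X) - of_bool (y \<notin> Y) = Suc k}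
      = X \<times> (- Y) \<union> (- X) \<times> Y"
    by (auto simp: of_bool_def split: if_splits)
  moreover have "card (X \<times> (- Y) \<union> (- X) \<times> Y) = card (X \<times> (- Y)) + card ((- X) \<times> Y)"
    by (intro card_Un_disjoint) auto
  ultimately have M1: "M (Suc k) = card X * card (- Y) + card (- X) * card Y"
    unfolding M by (simp only: card_cartesian_product)
  have "{(x, y). Suc (Suc k) - of_bool (x \<notin> X) - of_bool (y \<notin> Y) = k} = (- X) \<times> (- Y)"
    by (auto simp: of_bool_def split: if_splits)
  then have M0: "M k = card (- X) * card (- Y)"
    unfolding M by (simp only: card_cartesian_product)
  show "M (Suc (Suc k)) = 1" "M (Suc k) = 2 * CARD('a) - 2" "M k = (CARD('a) - 1)\<^sup>2" if "m = k"
  proof -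
    have "b0 \<noteq> 0" "a0 \<noteq> 0" using exp that by (auto simp: of_bool_def split: if_splits)
    then show "M (Suc (Suc k)) = 1" "M (Suc k) = 2 * CARD('a) - 2" "M k = (CARD('a) - 1)\<^sup>2"
      unfolding M0 M1 M2 X Y by (simp_all add: power2_eq_square)
  qed
  show "M (Suc k) = CARD('a)" "M k = (CARD('a))\<^sup>2 - CARD('a)" if "m = Suc k"
  proof -
    consider "b0 = 0" "a0 \<noteq> 0" | "b0 \<noteq> 0" "a0 = 0"
      using exp \<open>m = Suc k\<close> by (cases "b0 = 0"; cases "a0 = 0") auto
    then show "M (Suc k) = CARD('a)" "M k = (CARD('a))\<^sup>2 - CARD('a)"
      unfolding M0 M1 X Y
      by (cases; simp add: power2_eq_square diff_mult_distrib diff_mult_distrib2)+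
  qed
  show "M k = (CARD('a))\<^sup>2" if "m = Suc (Suc k)"
  proof -
    have "b0 = 0" "a0 = 0" using exp that by (auto simp: of_bool_def split: if_splits)
    then show ?thesis unfolding M0 X Y by (simp add: power2_eq_square)
  qed
qed

text \<open>In a plane the pencil is never identically zero, so the nullities \<open>0\<close> and \<open>1\<close> share all \<open>q\<^sup>2\<close> pairs;
it remains to count the points on a hyperbola or on a line.\<close>

lemma pencil_count_plane:
  fixes \<alpha> \<beta> f g :: "'b \<Rightarrow> 'a"
  assumes V: "subspace V" "finite V" and card: "card V = CARD('a) ^ 2"
    and func: "functional \<alpha>" "functional \<beta>" "functional f" "functional g"
    and K: "card {v \<in> V. f v = 0 \<and> \<beta> v = 0} = CARD('a) ^ 0"
    and L: "card {v \<in> V. g v = 0 \<and> \<alpha> v = 0} = CARD('a) ^ 0"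
    and m: "card {v \<in> V. \<beta> v = 0 \<and> \<alpha> v = 0} = CARD('a) ^ m"
  defines "M \<equiv> \<lambda>c. card {(x, y). card {v \<in> V. f v + x * \<beta> v = 0 \<and> g v + y * \<alpha> v = 0} = CARD('a) ^ c}"
  shows "m = 0 \<Longrightarrow> M 0 = (CARD('a))\<^sup>2 - CARD('a) + 1"
    and "m = 0 \<Longrightarrow> M 1 = CARD('a) - 1"
    and "m = 1 \<Longrightarrow> M 0 = (CARD('a))\<^sup>2 - CARD('a)"
    and "m = 1 \<Longrightarrow> M 1 = CARD('a)"
proof -
  have trivial: "v = 0" if "card {v \<in> V. h1 v = 0 \<and> h2 v = 0} = CARD('a) ^ 0"
    "v \<in> V" "h1 v = 0" "h2 v = 0" "functional h1" "functional h2" for v and h1 h2 :: "'b \<Rightarrow> 'a"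
  proof -
    have "0 \<in> {v \<in> V. h1 v = 0 \<and> h2 v = 0}"
      using that V subspace_0 functional_0 by blast
    moreover have "v \<in> {v \<in> V. h1 v = 0 \<and> h2 v = 0}" using that by blast
    moreover have "\<exists>w. {v \<in> V. h1 v = 0 \<and> h2 v = 0} = {w}"
      using that(1) by (simp add: card_1_singleton_iff)
    ultimately show ?thesis by (elim exE) (simp only: singleton_iff)
  qed
  note K' = trivial[OF K _ _ _ func(3,2)] and L' = trivial[OF L _ _ _ func(4,1)]
  have neq: "CARD('a) \<noteq> 1" "1 \<noteq> CARD('a)" using card_ge_2 by auto
  have count: "M 1 = card {(x, y). P x y}" "M 0 = (CARD('a))\<^sup>2 - card {(x, y). P x y}"
    if "\<forall>x y. card {v \<in> V. f v + x * \<beta> v = 0 \<and> g v + y * \<alpha> v = 0} = (if P x y then CARD('a) else 1)"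
    for P :: "'a \<Rightarrow> 'a \<Rightarrow> bool"
  proof -
    show "M 1 = card {(x, y). P x y}"
      unfolding M_def by (intro arg_cong[where f = card]) (use that neq in auto)
    have "M 0 = card (- {(x, y). P x y})"
      unfolding M_def by (intro arg_cong[where f = card]) (use that neq in auto)
    then show "M 0 = (CARD('a))\<^sup>2 - card {(x, y). P x y}"
      by (simp add: Compl_eq_Diff_UNIV card_Diff_subset power2_eq_square)
  qed
  show "M 0 = (CARD('a))\<^sup>2 - CARD('a) + 1" "M 1 = CARD('a) - 1" if "m = 0"
  proof -
    note B' = trivial[OF m[unfolded that] _ _ _ func(2,1)]
    obtain s b c where s: "s \<noteq> 0"
      and N: "\<forall>x y. card {v \<in> V. f v + x * \<beta> v = 0 \<and> g v + y * \<alpha> v = 0}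
        = (if s = (b + x) * (c + y) then CARD('a) else 1)"
      by (rule pencil_plane_regular[OF V card func]) (use K' L' B' in blast)+
    have "CARD('a) \<le> (CARD('a))\<^sup>2" by (simp add: power2_eq_square)
    then show "M 0 = (CARD('a))\<^sup>2 - CARD('a) + 1" "M 1 = CARD('a) - 1"
      using card_ge_2 unfolding count[OF N] card_hyperbola[OF s] by simp_all
  qed
  show "M 0 = (CARD('a))\<^sup>2 - CARD('a)" "M 1 = CARD('a)" if "m = 1"
  proof -
    have "card {v \<in> V. \<beta> v = 0 \<and> \<alpha> v = 0} > 1"
      using card_ge_2 unfolding m that by simp
    moreover have "card {v \<in> V. \<beta> v = 0 \<and> \<alpha> v = 0} \<le> card {0::'b}"
      if "{v \<in> V. \<beta> v = 0 \<and> \<alpha> v = 0} \<subseteq> {0}"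
      using that by (rule card_mono[rotated]) simp
    ultimately have "\<not> {v \<in> V. \<beta> v = 0 \<and> \<alpha> v = 0} \<subseteq> {0}"
      by (auto simp del: card_0_eq)
    then obtain z where z: "z \<in> V" "z \<noteq> 0" "\<alpha> z = 0" "\<beta> z = 0" by blast
    obtain c d l where d: "d \<noteq> 0"
      and N: "\<forall>x y. card {v \<in> V. f v + x * \<beta> v = 0 \<and> g v + y * \<alpha> v = 0}
        = (if x * d = c + y * l then CARD('a) else 1)"
      by (rule pencil_plane_singular[OF V card func _ _ z]) (use K' L' in blast)+
    show "M 0 = (CARD('a))\<^sup>2 - CARD('a)" "M 1 = CARD('a)"
      unfolding count[OF N] card_line[OF d] by simp_all
  qed
qed

lemma card_two_functionals_le:
  assumes V: "subspace V" "finite V" and func: "functional f" "functional h"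
    and v: "v \<in> V" "f v \<noteq> 0 \<or> h v \<noteq> 0"
  shows "CARD('a) * card {v \<in> V. f v = 0 \<and> h v = 0} \<le> card V"
proof -
  obtain \<phi> where \<phi>: "functional \<phi>" "\<phi> v \<noteq> 0"
    "{v \<in> V. f v = 0 \<and> h v = 0} \<subseteq> {v \<in> V. \<phi> v = 0}"
    using func v(2) by (cases "f v = 0") auto
  have "card {v \<in> V. f v = 0 \<and> h v = 0} \<le> card {v \<in> V. \<phi> v = 0}"
    using V(2) \<phi>(3) by (intro card_mono) auto
  then show ?thesis
    unfolding card_functional_zero[OF V \<phi>(1) v(1) \<phi>(2)] by simp
qed

text \<open>With \<open>K\<close> and \<open>L\<close> for the two subspaces of size \<open>q ^ e\<close> and \<open>W\<close> for their intersection, \<open>L \<noteq> K\<close> makes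
\<open>W\<close> a proper subspace of \<open>L\<close> and \<open>K\<close> a proper subspace of \<open>V\<close>. The first gives
\<open>|V| = q\<^sup>2 * |W| \<le> q * |L|\<close>, the second gives \<open>q * |K| \<le> |V|\<close>, and the two bounds agree.\<close>

lemma card_ambient_singular:
  assumes V: "subspace V" "finite V"
    and func: "functional \<alpha>" "functional \<beta>" "functional f" "functional g"
    and K: "card {v \<in> V. f v = 0 \<and> \<beta> v = 0} = CARD('a) ^ e"
    and L: "card {v \<in> V. g v = 0 \<and> \<alpha> v = 0} = CARD('a) ^ e"
    and W: "card V = (CARD('a))\<^sup>2 * card {v \<in> V. (g v = 0 \<and> \<alpha> v = 0) \<and> f v = 0 \<and> \<beta> v = 0}"
    and neq: "{v \<in> V. f v = 0 \<and> \<beta> v = 0} \<noteq> {v \<in> V. g v = 0 \<and> \<alpha> v = 0}"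
  shows "card V = CARD('a) ^ Suc e"
proof -
  let ?K = "{v \<in> V. f v = 0 \<and> \<beta> v = 0}" and ?L = "{v \<in> V. g v = 0 \<and> \<alpha> v = 0}"
  have "\<not> ?L \<subseteq> ?K"
    using card_subset_eq[of ?K ?L] K L neq V(2) by auto
  then obtain v where v: "v \<in> ?L" "f v \<noteq> 0 \<or> \<beta> v \<noteq> 0" by blast
  have "?L = {v \<in> {v \<in> V. g v = 0}. \<alpha> v = 0}" by blast
  then have subL: "subspace ?L"
    using subspace_functional_zero[OF subspace_functional_zero[OF V(1) func(4)] func(1)] by simp
  have "{v \<in> ?L. f v = 0 \<and> \<beta> v = 0} = {v \<in> V. (g v = 0 \<and> \<alpha> v = 0) \<and> f v = 0 \<and> \<beta> v = 0}"
    by blast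
  moreover have "CARD('a) * card {v \<in> ?L. f v = 0 \<and> \<beta> v = 0} \<le> card ?L"
    using V(2) by (intro card_two_functionals_le[OF subL _ func(3,2) v]) simp
  ultimately have "card V \<le> CARD('a) * CARD('a) ^ e"
    unfolding W L by (simp add: power2_eq_square)
  moreover have "CARD('a) * CARD('a) ^ e \<le> card V"
    using card_two_functionals_le[OF V func(3,2) _ v(2)] v(1) unfolding K by simp
  ultimately show ?thesis by simp
qed

lemma card_ambient_regular:
  assumes V: "subspace V" "finite V"
    and func: "functional \<alpha>" "functional \<beta>" "functional f" "functional g"
    and K: "card {v \<in> V. f v = 0 \<and> \<beta> v = 0} = 1"
    and W: "card V = (CARD('a))\<^sup>2 * card {v \<in> V. (g v = 0 \<and> \<alpha> v = 0) \<and> f v = 0 \<and> \<beta> v = 0}"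
  shows "card V = (CARD('a))\<^sup>2"
proof -
  let ?W = "{v \<in> V. (g v = 0 \<and> \<alpha> v = 0) \<and> f v = 0 \<and> \<beta> v = 0}"
  have "0 \<in> ?W" using V(1) func by (simp add: subspace_0 functional_0)
  then have "0 < card ?W" using V(2) by (auto simp: card_gt_0_iff)
  moreover have "card ?W \<le> 1"
    unfolding K[symmetric] using V(2) by (intro card_mono) auto
  ultimately have "card ?W = 1" by linarith
  then show ?thesis unfolding W by simp
qed

end

section \<open>Moment functionals and the kernels of Hankel matrices\<close>

interpretation poly_space: finite_field_space "Polynomial.smult :: 'a::{field,finite} \<Rightarrow> 'a poly \<Rightarrow> 'a poly"
  by unfold_locales (simp_all add: smult_add_right smult_add_left)

definition polys_below :: "nat \<Rightarrow> 'a::zero poly set" where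
  "polys_below m = {p. \<forall>j\<ge>m. coeff p j = 0}"

text \<open>The linear functional on polynomials that maps \<open>X ^ j\<close> to \<open>\<tau> j\<close>.\<close>

definition moment :: "(nat \<Rightarrow> 'a::comm_semiring_0) \<Rightarrow> 'a poly \<Rightarrow> 'a" where
  "moment \<tau> p = (\<Sum>j\<le>degree p. \<tau> j * coeff p j)"

text \<open>The kernel of the Hankel matrix with \<open>r\<close> rows, \<open>m\<close> columns and the entries \<open>\<tau> (i + j)\<close>. The
degree bound is imposed through the coefficients, so that \<open>m = 0\<close> leaves just the zero polynomial.\<close>

definition annihilated :: "(nat \<Rightarrow> 'a::comm_semiring_0) \<Rightarrow> nat \<Rightarrow> nat \<Rightarrow> 'a poly set" where
  "annihilated \<tau> m r = {p \<in> polys_below m. \<forall>i<r. moment (\<lambda>j. \<tau> (i + j)) p = 0}"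

lemma moment_eq_sum:
  assumes "p \<in> polys_below m"
  shows "moment \<tau> p = (\<Sum>j<m. \<tau> j * coeff p j)"
proof -
  have "moment \<tau> p = (\<Sum>j\<in>{..degree p} \<inter> {..<m}. \<tau> j * coeff p j)"
    unfolding moment_def using assms
    by (intro sum.mono_neutral_right) (auto simp: polys_below_def not_le[symmetric])
  also have "\<dots> = (\<Sum>j<m. \<tau> j * coeff p j)"
    by (intro sum.mono_neutral_left) (auto intro!: le_degree)
  finally show ?thesis .
qed

lemma polys_below_degree: "p \<in> polys_below (Suc (degree p))"
  by (auto simp: polys_below_def intro: coeff_eq_0)

lemma moment_smult: "moment \<tau> (Polynomial.smult c p) = c * moment \<tau> p"
proof -
  have "Polynomial.smult c p \<in> polys_below (Suc (degree p))"
    using polys_below_degree[of p] by (auto simp: polys_below_def)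
  then show ?thesis
    by (simp add: moment_eq_sum[OF polys_below_degree[of p]] moment_eq_sum sum_distrib_left mult_ac
        del: sum.lessThan_Suc)
qed

lemma moment_add: "moment \<tau> (p + w) = moment \<tau> p + moment \<tau> w"
proof -
  define m where "m = max (Suc (degree p)) (Suc (degree w))"
  have "p \<in> polys_below m" "w \<in> polys_below m"
    using polys_below_degree[of p] polys_below_degree[of w] by (auto simp: m_def polys_below_def)
  moreover from this have "p + w \<in> polys_below m" by (simp add: polys_below_def)
  ultimately show ?thesis by (simp add: moment_eq_sum sum.distrib distrib_left)
qed

lemma moment_0 [simp]: "moment \<tau> 0 = 0"
  by (simp add: moment_def)

lemma moment_shift: "moment \<tau> (pCons 0 p) = moment (\<lambda>j. \<tau> (Suc j)) p"
proof -
  have p: "p \<in> polys_below (Suc (degree p))" by (rule polys_below_degree)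
  have "pCons 0 p \<in> polys_below (Suc (Suc (degree p)))"
    by (auto simp: polys_below_def coeff_pCons split: nat.split intro: coeff_eq_0)
  from moment_eq_sum[OF this] moment_eq_sum[OF p] show ?thesis
    by (simp add: sum.lessThan_Suc_shift del: sum.lessThan_Suc)
qed

lemma moment_mult_pCons:
  "moment \<tau> (p * pCons c w) = c * moment \<tau> p + moment (\<lambda>j. \<tau> (Suc j)) (p * w)"
  by (simp add: mult_pCons_right moment_add moment_smult moment_shift)

lemma functional_moment: "poly_space.functional (moment \<tau>)"
  by (intro poly_space.functionalI moment_add moment_smult)

lemma functional_coeff: "poly_space.functional (\<lambda>p. coeff p j)"
  by (intro poly_space.functionalI) simp_all

lemma polys_below_0: "polys_below 0 = {0}"
  by (auto simp: polys_below_def poly_eq_iff)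

lemma pCons_in_polys_below: "pCons c p \<in> polys_below (Suc m) \<longleftrightarrow> p \<in> polys_below m"
  by (force simp: polys_below_def coeff_pCons split: nat.split dest: Suc_le_D)

lemma polys_below_Suc: "polys_below (Suc m) = (\<lambda>(c, p). pCons c p) ` (UNIV \<times> polys_below m)"
proof (intro equalityI subsetI)
  fix p :: "'a poly" assume p: "p \<in> polys_below (Suc m)"
  obtain c w where pw: "p = pCons c w" by (cases p)
  with p have "w \<in> polys_below m" by (simp add: pCons_in_polys_below)
  with pw show "p \<in> (\<lambda>(c, p). pCons c p) ` (UNIV \<times> polys_below m)" by blast
qed (auto simp: pCons_in_polys_below)

lemma finite_polys_below: "finite (polys_below m :: 'a::{zero,finite} poly set)"
  by (induction m) (simp_all add: polys_below_0 polys_below_Suc)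

lemma card_polys_below: "card (polys_below m :: 'a::{zero,finite} poly set) = CARD('a) ^ m"
proof (induction m)
  case (Suc m)
  have "inj_on (\<lambda>(c, p). pCons c p) (UNIV \<times> (polys_below m :: 'a poly set))"
    by (auto simp: inj_on_def)
  from card_image[OF this] Suc show ?case
    by (simp add: polys_below_Suc card_cartesian_product)
qed (simp add: polys_below_0)

lemma subspace_polys_below: "poly_space.subspace (polys_below m)"
  by (auto simp: poly_space.subspace_def polys_below_def)

lemma subspace_annihilated: "poly_space.subspace (annihilated \<tau> m r)"
  using subspace_polys_below[of m]
  by (auto simp: poly_space.subspace_def annihilated_def moment_add moment_smult)

lemma finite_annihilated: "finite (annihilated \<tau> m r :: 'a::{comm_semiring_0,finite} poly set)"
  by (rule finite_subset[OF _ finite_polys_below[of m]]) (auto simp: annihilated_def)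

lemma moment_mult_eq_0:
  assumes "w \<in> polys_below r" "\<And>i. i < r \<Longrightarrow> moment (\<lambda>j. \<tau> (i + j)) p = 0"
  shows "moment \<tau> (p * w) = 0"
  using assms
proof (induction w arbitrary: r \<tau>)
  case (pCons c w)
  show ?case
  proof (cases r)
    case 0
    then show ?thesis using pCons.prems(1) by (simp add: polys_below_0 del: pCons_eq_0_iff)
  next
    case (Suc s)
    have "moment (\<lambda>j. \<tau> (Suc j)) (p * w) = 0"
      using pCons.prems(2)[of "Suc _"] pCons.prems(1) unfolding Suc
      by (intro pCons.IH[of s]) (simp_all add: pCons_in_polys_below)
    then show ?thesis using pCons.prems(2)[of 0] Suc by (simp only: moment_mult_pCons) simp
  qed
qed simp

lemma moment_mult_monom:
  fixes \<tau> :: "nat \<Rightarrow> 'a::comm_semiring_1"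
  shows "moment \<tau> (p * monom 1 i) = moment (\<lambda>j. \<tau> (i + j)) p"
  by (induction i arbitrary: \<tau>) (simp_all add: monom_Suc moment_shift moment_smult monom_0)

text \<open>Row \<open>i\<close> is the functional \<open>p \<mapsto> \<tau> (p * X ^ i)\<close>. This makes \<open>annihilated \<tau> m r\<close> the left kernel of
the pairing \<open>(p, w) \<mapsto> \<tau> (p * w)\<close>, which is symmetric in its two arguments.\<close>

lemma annihilated_iff:
  fixes \<tau> :: "nat \<Rightarrow> 'a::comm_semiring_1"
  shows "p \<in> annihilated \<tau> m r \<longleftrightarrow> p \<in> polys_below m \<and> (\<forall>w\<in>polys_below r. moment \<tau> (p * w) = 0)"
proof -
  have "monom 1 i \<in> polys_below r" if "i < r" for i
    using that by (simp add: polys_below_def)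
  then have "moment (\<lambda>j. \<tau> (i + j)) p = 0"
    if "\<forall>w\<in>polys_below r. moment \<tau> (p * w) = 0" "i < r" for i
    using that moment_mult_monom[of \<tau> p i] by metis
  then show ?thesis
    unfolding annihilated_def using moment_mult_eq_0[of _ r \<tau> p] by blast
qed

text \<open>Each \<open>p\<close> in the left kernel of the pairing is orthogonal to all \<open>q ^ r\<close> polynomials \<open>w\<close>, every other
\<open>p\<close> to a fraction \<open>1 / q\<close> of them. Multiplying by \<open>q\<close> avoids the exponent \<open>r - 1\<close>.\<close>

lemma card_orthogonal_pairs:
  fixes \<tau> :: "nat \<Rightarrow> 'a::{field,finite}"
  shows "CARD('a) * card {(p, w). p \<in> polys_below m \<and> w \<in> polys_below r \<and> moment \<tau> (p * w) = 0}
    = CARD('a) ^ r * (CARD('a) ^ m + (CARD('a) - 1) * card (annihilated \<tau> m r))"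
proof -
  let ?P = "polys_below m :: 'a poly set" and ?R = "polys_below r :: 'a poly set"
    and ?A = "annihilated \<tau> m r" and ?q = "CARD('a)"
  have slice: "?q * card {w \<in> ?R. moment \<tau> (p * w) = 0}
      = ?q ^ r + (if p \<in> ?A then (?q - 1) * ?q ^ r else 0)" if p: "p \<in> ?P" for p
  proof (cases "p \<in> ?A")
    case True
    then have "{w \<in> ?R. moment \<tau> (p * w) = 0} = ?R" using annihilated_iff by blast
    then show ?thesis
      using True by (simp add: card_polys_below algebra_simps)
  next
    case False
    then obtain w where "w \<in> ?R" "moment \<tau> (p * w) \<noteq> 0"
      using p annihilated_iff by blast
    moreover have "poly_space.functional (\<lambda>w. moment \<tau> (p * w))"
      by (intro poly_space.functionalI) (simp_all add: distrib_left moment_add moment_smult)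
    ultimately have "card ?R = ?q * card {w \<in> ?R. moment \<tau> (p * w) = 0}"
      using poly_space.card_functional_zero[OF subspace_polys_below finite_polys_below] by blast
    then show ?thesis using False by (simp add: card_polys_below)
  qed
  have "{(p, w). p \<in> ?P \<and> w \<in> ?R \<and> moment \<tau> (p * w) = 0}
      = Sigma ?P (\<lambda>p. {w \<in> ?R. moment \<tau> (p * w) = 0})"
    by blast
  then have "?q * card {(p, w). p \<in> ?P \<and> w \<in> ?R \<and> moment \<tau> (p * w) = 0}
      = (\<Sum>p\<in>?P. ?q * card {w \<in> ?R. moment \<tau> (p * w) = 0})"
    by (simp add: finite_polys_below sum_distrib_left)
  also have "\<dots> = (\<Sum>p\<in>?P. ?q ^ r + (if p \<in> ?A then (?q - 1) * ?q ^ r else 0))"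
    by (intro sum.cong refl slice)
  also have "\<dots> = card ?P * ?q ^ r + card (?P \<inter> ?A) * ((?q - 1) * ?q ^ r)"
    by (simp add: sum.distrib finite_polys_below sum.If_cases Int_def)
  also have "?P \<inter> ?A = ?A" by (auto simp: annihilated_def)
  finally show ?thesis by (simp add: card_polys_below algebra_simps)
qed

text \<open>A matrix and its transpose have the same rank: the left side of \<open>card_orthogonal_pairs\<close> is
symmetric in \<open>m\<close> and \<open>r\<close>.\<close>

lemma card_annihilated_swap:
  fixes \<tau> :: "nat \<Rightarrow> 'a::{field,finite}"
  shows "CARD('a) ^ r * card (annihilated \<tau> m r) = CARD('a) ^ m * card (annihilated \<tau> r m)"
proof -
  let ?E = "\<lambda>m r. {(p, w). p \<in> polys_below m \<and> w \<in> polys_below r \<and> moment \<tau> (p * w) = 0}"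
  have "bij_betw prod.swap (?E m r) (?E r m)"
    by (rule bij_betwI[where g = prod.swap]) (auto simp: mult.commute)
  then have eq: "card (?E m r) = card (?E r m)" by (rule bij_betw_same_card)
  have "CARD('a) ^ r * CARD('a) ^ m + (CARD('a) - 1) * (CARD('a) ^ r * card (annihilated \<tau> m r))
      = CARD('a) ^ m * CARD('a) ^ r + (CARD('a) - 1) * (CARD('a) ^ m * card (annihilated \<tau> r m))"
    using card_orthogonal_pairs[of m r \<tau>] card_orthogonal_pairs[of r m \<tau>] eq
    by (simp only: distrib_left mult.left_commute)
  then have "(CARD('a) - 1) * (CARD('a) ^ r * card (annihilated \<tau> m r))
      = (CARD('a) - 1) * (CARD('a) ^ m * card (annihilated \<tau> r m))"
    by (simp only: mult.commute add_left_cancel)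
  moreover have "CARD('a) - 1 \<noteq> 0" using poly_space.card_ge_2[where 'a = 'a] by simp
  ultimately show ?thesis by (simp only: mult_cancel1) simp
qed

lemma card_image_shift: "card ((\<lambda>p. pCons 0 p) ` P) = card P"
  by (intro card_image) (simp add: inj_on_def)

lemma annihilated_shift_mem:
  "pCons 0 p \<in> annihilated \<tau> (Suc m) r \<longleftrightarrow> p \<in> annihilated (\<lambda>j. \<tau> (Suc j)) m r"
  by (simp add: annihilated_def pCons_in_polys_below moment_shift)

lemma shift_image_iff: "p \<in> (\<lambda>p. pCons 0 p) ` P \<longleftrightarrow> coeff p 0 = 0 \<and> (\<forall>w. p = pCons 0 w \<longrightarrow> w \<in> P)"
  by (cases p) auto

lemma polys_below_Suc_iff: "p \<in> polys_below m \<longleftrightarrow> p \<in> polys_below (Suc m) \<and> coeff p m = 0"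
  by (auto simp: polys_below_def) (metis le_antisym not_less_eq_eq)

text \<open>Multiplication by \<open>X\<close> raises the largest degree that occurs in \<open>P\<close>.\<close>

lemma shift_not_invariant:
  fixes P :: "'a::zero poly set"
  assumes "finite P" "p \<in> P" "p \<noteq> 0"
  shows "P \<noteq> (\<lambda>p. pCons 0 p) ` P"
proof
  assume eq: "P = (\<lambda>p. pCons 0 p) ` P"
  have "finite (P - {0})" "P - {0} \<noteq> {}" using assms by auto
  then obtain w where w: "w \<in> P - {0}" and max: "\<forall>u\<in>P - {0}. degree u \<le> degree w"
    using Max_in[of "degree ` (P - {0})"] Max_ge[of "degree ` (P - {0})"]
    by (smt (verit) finite_imageI image_iff image_is_empty)
  have "pCons 0 w \<in> P" using w by (subst eq) blast
  then have "pCons 0 w \<in> P - {0}" using w by simp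
  then have "degree (pCons 0 w) \<le> degree w" using max by blast
  then show False using w by simp
qed

text \<open>This and the following three lemmas cut kernels of other shapes out of one larger kernel. A vanishing
highest coefficient removes a column on one side, a vanishing lowest coefficient removes one on the
other side after division by \<open>X\<close>, and a further moment condition adds a row.\<close>

lemma annihilated_top:
  "annihilated \<tau> (Suc m) (Suc r)
    = {p \<in> annihilated \<tau> (Suc (Suc m)) r. moment (\<lambda>j. \<tau> (r + j)) p = 0 \<and> coeff p (Suc m) = 0}"
  using polys_below_Suc_iff[of _ "Suc m"] by (auto simp: annihilated_def less_Suc_eq)

text \<open>The additional row has index \<open>-1\<close>. Its entry \<open>\<tau> (-1)\<close> multiplies the constant term, so on
polynomials without constant term every choice gives the same functional; \<open>case_nat 0 \<tau>\<close> takes zero.\<close>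

lemma annihilated_lower:
  fixes \<tau> :: "nat \<Rightarrow> 'a::comm_semiring_0"
  shows "{p \<in> annihilated \<tau> (Suc m) r. moment (case_nat 0 \<tau>) p = 0 \<and> coeff p 0 = 0}
    = (\<lambda>p. pCons 0 p) ` annihilated \<tau> m (Suc r)" (is "?S = ?I")
proof -
  have "p \<in> ?S \<longleftrightarrow> p \<in> ?I" for p
    by (cases p) (auto simp: shift_image_iff annihilated_shift_mem moment_shift annihilated_def
        pCons_in_polys_below All_less_Suc2)
  then show ?thesis by blast
qed

lemma annihilated_outer:
  fixes \<tau> :: "nat \<Rightarrow> 'a::comm_semiring_0"
  shows "{p \<in> annihilated \<tau> (Suc (Suc m)) r. coeff p (Suc m) = 0 \<and> coeff p 0 = 0}
    = (\<lambda>p. pCons 0 p) ` annihilated (\<lambda>j. \<tau> (Suc j)) m r" (is "?S = ?I")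
proof -
  have "p \<in> ?S \<longleftrightarrow> p \<in> ?I" for p
    by (cases p) (auto simp: shift_image_iff annihilated_def moment_shift pCons_in_polys_below
        polys_below_Suc_iff[of _ m])
  then show ?thesis by blast
qed

lemma annihilated_inner:
  fixes \<tau> :: "nat \<Rightarrow> 'a::comm_semiring_0"
  shows "{p \<in> annihilated \<tau> (Suc (Suc m)) r. (moment (case_nat 0 \<tau>) p = 0 \<and> coeff p 0 = 0)
      \<and> moment (\<lambda>j. \<tau> (r + j)) p = 0 \<and> coeff p (Suc m) = 0}
    = (\<lambda>p. pCons 0 p) ` annihilated \<tau> m (Suc (Suc r))" (is "?S = ?I")
proof -
  have "?S = {p \<in> (\<lambda>p. pCons 0 p) ` annihilated \<tau> (Suc m) (Suc r).
      moment (\<lambda>j. \<tau> (r + j)) p = 0 \<and> coeff p (Suc m) = 0}"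
    using annihilated_lower[of \<tau> "Suc m" r] by blast
  also have "\<dots> = ?I"
    by (auto simp: annihilated_def moment_shift pCons_in_polys_below polys_below_Suc_iff[of _ m] less_Suc_eq)
  finally show ?thesis .
qed

section \<open>Kernels of Toeplitz matrices\<close>

text \<open>Coordinates with respect to a basis of the kernel are unique.\<close>

lemma card_mat_kernel:
  fixes A :: "'a::{field,finite} mat"
  assumes A: "A \<in> carrier_mat nr nc"
  shows "card (mat_kernel A) = CARD('a) ^ kernel_dim A"
proof -
  interpret kernel nr nc A by unfold_locales (rule A)
  obtain b where b: "finite b" "basis b" using kernel_basis_exists[OF A] by blast
  then have sub: "b \<subseteq> mat_kernel A" unfolding Ker.basis_def by blast
  have ex1: "\<exists>!c. c \<in> b \<rightarrow>\<^sub>E UNIV \<and> lincomb c b = v" if "v \<in> mat_kernel A" for v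
    using Ker.basis_criterion[OF b(1) sub] b(2) that by blast
  have closed: "lincomb c b \<in> mat_kernel A" for c
    using Ker.lincomb_closed[OF sub] by blast
  have "bij_betw (\<lambda>c. lincomb c b) (b \<rightarrow>\<^sub>E UNIV) (mat_kernel A)"
    unfolding bij_betw_def inj_on_def
  proof (intro conjI ballI impI equalityI subsetI)
    fix v assume "v \<in> mat_kernel A"
    then show "v \<in> (\<lambda>c. lincomb c b) ` (b \<rightarrow>\<^sub>E UNIV)" using ex1 by blast
  next
    fix c d assume "c \<in> b \<rightarrow>\<^sub>E UNIV" "d \<in> b \<rightarrow>\<^sub>E UNIV" "lincomb c b = lincomb d b"
    then show "c = d" using ex1[OF closed[of d]] by blast
  qed (use closed in blast)
  from bij_betw_same_card[OF this] have "card (mat_kernel A) = CARD('a) ^ card b"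
    by (simp add: card_PiE b(1))
  also have "card b = kernel_dim A" using Ker.dim_basis[OF b] by simp
  finally show ?thesis .
qed

text \<open>All entries of the matrix, from the bottom left to the top right corner.\<close>

definition toeplitz_seq :: "nat \<Rightarrow> (nat \<Rightarrow> 'a) \<Rightarrow> (nat \<Rightarrow> 'a) \<Rightarrow> nat \<Rightarrow> 'a" where
  "toeplitz_seq n a b k = (if n \<le> k then a (k - n) else b (n - k))"

lemma in_mat_kernel_toeplitz:
  fixes a b :: "nat \<Rightarrow> 'a::comm_ring_1"
  assumes p: "p \<in> polys_below (Suc n)"
  shows "vec (Suc n) (coeff p) \<in> mat_kernel (toeplitz_mat n a b)
    \<longleftrightarrow> p \<in> annihilated (toeplitz_seq n a b) (Suc n) (Suc n)"
proof -
  let ?T = "toeplitz_mat n a b" and ?v = "vec (Suc n) (coeff p)"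
  have T: "?T \<in> carrier_mat (Suc n) (Suc n)" by (simp add: toeplitz_mat_def)
  have entry: "?T $$ (n - i, j) = toeplitz_seq n a b (i + j)" if "i \<le> n" "j \<le> n" for i j
  proof (cases "n \<le> i + j")
    case True
    then have "n - i \<le> j" "j - (n - i) = i + j - n" using that by auto
    then show ?thesis using True that by (simp add: toeplitz_mat_def toeplitz_seq_def)
  next
    case False
    then have "\<not> n - i \<le> j" "n - i - j = n - (i + j)" using that by auto
    then show ?thesis using False that by (simp add: toeplitz_mat_def toeplitz_seq_def)
  qed
  have row: "(?T *\<^sub>v ?v) $ (n - i) = moment (\<lambda>j. toeplitz_seq n a b (i + j)) p" if "i \<le> n" for i
  proof -
    have "(?T *\<^sub>v ?v) $ (n - i) = (\<Sum>j<Suc n. ?T $$ (n - i, j) * coeff p j)"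
      using T by (simp add: scalar_prod_def atLeast0LessThan del: sum.lessThan_Suc)
    also have "\<dots> = moment (\<lambda>j. toeplitz_seq n a b (i + j)) p"
      unfolding moment_eq_sum[OF p] using that by (intro sum.cong) (auto simp: entry)
    finally show ?thesis .
  qed
  have "?v \<in> mat_kernel ?T \<longleftrightarrow> ?T *\<^sub>v ?v = 0\<^sub>v (Suc n)"
    unfolding mat_kernel[OF T] by simp
  also have "\<dots> \<longleftrightarrow> (\<forall>k\<le>n. (?T *\<^sub>v ?v) $ k = 0)"
    by (auto simp: vec_eq_iff toeplitz_mat_def less_Suc_eq_le)
  also have "\<dots> \<longleftrightarrow> (\<forall>i\<le>n. (?T *\<^sub>v ?v) $ (n - i) = 0)"
    by (metis diff_diff_cancel diff_le_self)
  also have "\<dots> \<longleftrightarrow> p \<in> annihilated (toeplitz_seq n a b) (Suc n) (Suc n)"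
    using p row by (auto simp: annihilated_def less_Suc_eq_le)
  finally show ?thesis .
qed

lemma card_annihilated_toeplitz:
  fixes a b :: "nat \<Rightarrow> 'a::{field,finite}"
  shows "card (annihilated (toeplitz_seq n a b) (Suc n) (Suc n))
    = CARD('a) ^ kernel_dim (toeplitz_mat n a b)"
proof -
  let ?T = "toeplitz_mat n a b" and ?ann = "annihilated (toeplitz_seq n a b) (Suc n) (Suc n)"
  have T: "?T \<in> carrier_mat (Suc n) (Suc n)" by (simp add: toeplitz_mat_def)
  have below: "p \<in> polys_below (Suc n)" if "p \<in> ?ann" for p
    using that by (simp add: annihilated_def)
  have "bij_betw (\<lambda>p. vec (Suc n) (coeff p)) ?ann (mat_kernel ?T)"
    unfolding bij_betw_def inj_on_def
  proof (intro conjI ballI impI equalityI subsetI)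
    fix p w assume pw: "p \<in> ?ann" "w \<in> ?ann" "vec (Suc n) (coeff p) = vec (Suc n) (coeff w)"
    have "coeff p j = coeff w j" for j
    proof (cases "j < Suc n")
      case True
      then show ?thesis using pw(3) by (metis index_vec)
    next
      case False
      then show ?thesis using below[OF pw(1)] below[OF pw(2)] by (simp add: polys_below_def)
    qed
    then show "p = w" by (simp add: poly_eq_iff)
  next
    fix v assume v: "v \<in> mat_kernel ?T"
    define p where "p = Poly (list_of_vec v)"
    have dim: "dim_vec v = Suc n" using mat_kernelD(1)[OF T v] by simp
    have coeff: "coeff p j = (if j < Suc n then v $ j else 0)" for j
      by (simp add: p_def nth_default_def dim list_of_vec_index)
    then have p: "p \<in> polys_below (Suc n)" by (simp add: polys_below_def)
    have "vec (Suc n) (coeff p) = v" using dim coeff by auto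
    then show "v \<in> (\<lambda>p. vec (Suc n) (coeff p)) ` ?ann"
      using in_mat_kernel_toeplitz[OF p, of a b] v by force
  qed (use in_mat_kernel_toeplitz[OF below] in blast)
  from bij_betw_same_card[OF this] show ?thesis
    unfolding card_mat_kernel[OF T] .
qed

text \<open>The new corner entries sit at the two ends of the sequence of the enlarged matrix. Since
\<open>a (n + 1)\<close> lies outside \<open>\<A>\<^sub>n\<close>, it may be normalized to zero.\<close>

lemma toeplitz_seq_extend:
  assumes "a (Suc n) = 0"
  shows "toeplitz_seq (Suc n) (a(Suc n := x)) (b(Suc n := y)) 0 = y"
    and "toeplitz_seq (Suc n) (a(Suc n := x)) (b(Suc n := y)) (Suc k)
      = toeplitz_seq n a b k + (if k = Suc (2 * n) then x else (0::'a::ab_group_add))"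
  using assms by (auto simp: toeplitz_seq_def Suc_diff_le)

text \<open>Only the first and last rows of the Hankel matrix meet the corners: \<open>y\<close> multiplies the lowest
coefficient and \<open>x\<close> the highest one.\<close>

lemma annihilated_extend:
  fixes a b :: "nat \<Rightarrow> 'a::field"
  assumes a: "a (Suc n) = 0"
  defines "\<tau> \<equiv> toeplitz_seq n a b"
  shows "annihilated (toeplitz_seq (Suc n) (a(Suc n := x)) (b(Suc n := y))) (Suc (Suc n)) (Suc (Suc n))
    = {p \<in> annihilated \<tau> (Suc (Suc n)) n. moment (\<lambda>j. \<tau> (n + j)) p + x * coeff p (Suc n) = 0
        \<and> moment (case_nat 0 \<tau>) p + y * coeff p 0 = 0}"
proof -
  let ?\<mu> = "toeplitz_seq (Suc n) (a(Suc n := x)) (b(Suc n := y))"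
  have rows: "moment ?\<mu> p = moment (case_nat 0 \<tau>) p + y * coeff p 0"
    "i < n \<Longrightarrow> moment (\<lambda>j. ?\<mu> (Suc i + j)) p = moment (\<lambda>j. \<tau> (i + j)) p"
    "moment (\<lambda>j. ?\<mu> (Suc n + j)) p = moment (\<lambda>j. \<tau> (n + j)) p + x * coeff p (Suc n)"
    if p: "p \<in> polys_below (Suc (Suc n))" for p i
  proof -
    show "moment ?\<mu> p = moment (case_nat 0 \<tau>) p + y * coeff p 0"
      unfolding moment_eq_sum[OF p] sum.lessThan_Suc_shift
      by (simp add: toeplitz_seq_extend[of a n, OF a] \<tau>_def)
    show "moment (\<lambda>j. ?\<mu> (Suc i + j)) p = moment (\<lambda>j. \<tau> (i + j)) p" if "i < n"
      unfolding moment_eq_sum[OF p] using that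
      by (intro sum.cong) (auto simp: toeplitz_seq_extend[of a n, OF a] \<tau>_def)
    show "moment (\<lambda>j. ?\<mu> (Suc n + j)) p = moment (\<lambda>j. \<tau> (n + j)) p + x * coeff p (Suc n)"
      unfolding moment_eq_sum[OF p]
      by (simp add: toeplitz_seq_extend[of a n, OF a] \<tau>_def algebra_simps)
  qed
  have "(\<forall>i<Suc (Suc n). moment (\<lambda>j. ?\<mu> (i + j)) p = 0)
      \<longleftrightarrow> (\<forall>i<n. moment (\<lambda>j. \<tau> (i + j)) p = 0)
        \<and> moment (\<lambda>j. \<tau> (n + j)) p + x * coeff p (Suc n) = 0
        \<and> moment (case_nat 0 \<tau>) p + y * coeff p 0 = 0"
    if p: "p \<in> polys_below (Suc (Suc n))" for p
  proof -
    have "(\<forall>i<Suc (Suc n). Q i) \<longleftrightarrow> Q 0 \<and> (\<forall>i<n. Q (Suc i)) \<and> Q (Suc n)" for Q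
      by (subst All_less_Suc2) (auto simp: less_Suc_eq)
    then show ?thesis using rows[OF p] by auto
  qed
  then show ?thesis by (auto simp: annihilated_def)
qed

lemma toeplitz_ext_iff:
  "toeplitz_ext n (toeplitz_mat n a b) A' \<longleftrightarrow>
    (\<exists>x y. A' = toeplitz_mat (Suc n) (a(Suc n := x)) (b(Suc n := y)))"
proof
  assume "toeplitz_ext n (toeplitz_mat n a b) A'"
  then obtain a' b' where A': "A' = toeplitz_mat (Suc n) a' b'"
    and eq: "toeplitz_mat n a b = mat (n + 1) (n + 1) (\<lambda>(i, j). A' $$ (i, j))"
    unfolding toeplitz_ext_def is_toeplitz_def by auto
  have "a j = a' j" if "j \<le> n" for j
    using arg_cong[OF eq, of "\<lambda>M. M $$ (0, j)"] that by (simp add: A' toeplitz_mat_def)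
  moreover have "b i = b' i" if "i \<le> n" "i \<noteq> 0" for i
    using arg_cong[OF eq, of "\<lambda>M. M $$ (i, 0)"] that by (simp add: A' toeplitz_mat_def)
  ultimately have "A' = toeplitz_mat (Suc n) (a(Suc n := a' (Suc n))) (b(Suc n := b' (Suc n)))"
    unfolding A' toeplitz_mat_def by (intro cong_mat) auto
  then show "\<exists>x y. A' = toeplitz_mat (Suc n) (a(Suc n := x)) (b(Suc n := y))" by blast
next
  assume "\<exists>x y. A' = toeplitz_mat (Suc n) (a(Suc n := x)) (b(Suc n := y))"
  then obtain x y where A': "A' = toeplitz_mat (Suc n) (a(Suc n := x)) (b(Suc n := y))" by blast
  have "toeplitz_mat n a b = mat (n + 1) (n + 1) (\<lambda>(i, j). A' $$ (i, j))"
    unfolding A' toeplitz_mat_def by (intro cong_mat) auto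
  then show "toeplitz_ext n (toeplitz_mat n a b) A'"
    using A' unfolding toeplitz_ext_def is_toeplitz_def by (metis Suc_eq_plus1)
qed

lemma num_ext_eq_card_pairs:
  fixes a b :: "nat \<Rightarrow> 'a::field"
  shows "num_ext_with_nullity n (toeplitz_mat n a b) c
    = card {(x, y). kernel_dim (toeplitz_mat (Suc n) (a(Suc n := x)) (b(Suc n := y))) = c}"
proof -
  let ?E = "\<lambda>(x, y). toeplitz_mat (Suc n) (a(Suc n := x)) (b(Suc n := y))"
  have "inj ?E"
  proof (rule injI, clarsimp)
    fix x y x' y'
    assume eq: "toeplitz_mat (Suc n) (a(Suc n := x)) (b(Suc n := y))
      = toeplitz_mat (Suc n) (a(Suc n := x')) (b(Suc n := y'))"
    show "x = x' \<and> y = y'"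
      using arg_cong[OF eq, of "\<lambda>M. M $$ (0, Suc n)"] arg_cong[OF eq, of "\<lambda>M. M $$ (Suc n, 0)"]
      by (simp add: toeplitz_mat_def)
  qed
  then have "inj_on ?E {(x, y). kernel_dim (?E (x, y)) = c}" by (rule inj_on_subset) simp
  moreover have "{A'. toeplitz_ext n (toeplitz_mat n a b) A' \<and> kernel_dim A' = c}
      = ?E ` {(x, y). kernel_dim (?E (x, y)) = c}"
    unfolding toeplitz_ext_iff by auto
  ultimately show ?thesis
    unfolding num_ext_with_nullity_def by (simp add: card_image)
qed

section \<open>The nullities of Toeplitz extensions\<close>

theorem mainTheorem2:
  fixes A B :: "'a :: {field, finite} mat" and n q :: nat
  assumes q: "q = card (UNIV :: 'a set)"
    and n: "n \<ge> 1"
    and ext: "toeplitz_ext (n - 1) B A"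
  shows
    "(kernel_dim B = 0 \<and> kernel_dim A = 0 \<longrightarrow> num_ext_with_nullity n A 0 = q^2 - q + 1)
   \<and> (kernel_dim B = 0 \<and> kernel_dim A = 0 \<longrightarrow> num_ext_with_nullity n A 1 = q - 1)
   \<and> (kernel_dim B = 1 \<and> kernel_dim A = 0 \<longrightarrow> num_ext_with_nullity n A 0 = q^2 - q)
   \<and> (kernel_dim B = 1 \<and> kernel_dim A = 0 \<longrightarrow> num_ext_with_nullity n A 1 = q)
   \<and> (\<forall>d\<ge>1. kernel_dim B = d - 1 \<and> kernel_dim A = d \<longrightarrow> num_ext_with_nullity n A (d + 1) = 1)
   \<and> (\<forall>d\<ge>1. kernel_dim B = d - 1 \<and> kernel_dim A = d \<longrightarrow> num_ext_with_nullity n A d = 2 * q - 2)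
   \<and> (\<forall>d\<ge>1. kernel_dim B = d - 1 \<and> kernel_dim A = d \<longrightarrow> num_ext_with_nullity n A (d - 1) = (q - 1)^2)
   \<and> (\<forall>d\<ge>1. kernel_dim B = d \<and> kernel_dim A = d \<longrightarrow> num_ext_with_nullity n A d = q)
   \<and> (\<forall>d\<ge>1. kernel_dim B = d \<and> kernel_dim A = d \<longrightarrow> num_ext_with_nullity n A (d - 1) = q^2 - q)
   \<and> (\<forall>d\<ge>2. kernel_dim B = d \<and> kernel_dim A = d - 1 \<longrightarrow> num_ext_with_nullity n A (d - 2) = q^2)"
proof -
  obtain l where l: "n = Suc l" using n by (cases n) auto
  obtain a' b where A': "A = toeplitz_mat n a' b"
    and B': "B = mat n n (\<lambda>(i, j). A $$ (i, j))"
    using ext n unfolding toeplitz_ext_def is_toeplitz_def by auto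
  \<comment> \<open>The entry \<open>a' (Suc n)\<close> does not occur in \<open>A\<close>; it is set to zero as \<open>annihilated_extend\<close> requires.\<close>
  define a where "a = a'(Suc n := 0)"
  have a: "a (Suc n) = 0" by (simp add: a_def)
  have A: "A = toeplitz_mat n a b"
    unfolding A' toeplitz_mat_def a_def by (intro cong_mat) auto
  have B: "B = toeplitz_mat l a b"
    unfolding B' A toeplitz_mat_def l by (intro cong_mat) auto
  define \<tau> where "\<tau> = toeplitz_seq n a b"
  define V where "V = annihilated \<tau> (Suc (Suc n)) n"
  define \<alpha> :: "'a poly \<Rightarrow> 'a" where "\<alpha> = (\<lambda>p. coeff p 0)"
  define \<beta> :: "'a poly \<Rightarrow> 'a" where "\<beta> = (\<lambda>p. coeff p (Suc n))"
  define f where "f = moment (\<lambda>j. \<tau> (n + j))"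
  define g where "g = moment (case_nat 0 \<tau>)"
  let ?K = "annihilated \<tau> (Suc n) (Suc n)"
  have V: "poly_space.subspace V" "finite V"
    unfolding V_def by (rule subspace_annihilated finite_annihilated)+
  have func: "poly_space.functional \<alpha>" "poly_space.functional \<beta>"
    "poly_space.functional f" "poly_space.functional g"
    unfolding \<alpha>_def \<beta>_def f_def g_def by (rule functional_coeff functional_moment)+

  have setK: "{v \<in> V. f v = 0 \<and> \<beta> v = 0} = ?K"
    unfolding V_def f_def \<beta>_def by (rule annihilated_top[symmetric])
  have setL: "{v \<in> V. g v = 0 \<and> \<alpha> v = 0} = (\<lambda>p. pCons 0 p) ` ?K"
    unfolding V_def g_def \<alpha>_def by (rule annihilated_lower)
  have cardK: "card {v \<in> V. f v = 0 \<and> \<beta> v = 0} = CARD('a) ^ kernel_dim A"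
    unfolding setK A \<tau>_def by (rule card_annihilated_toeplitz)
  have cardL: "card {v \<in> V. g v = 0 \<and> \<alpha> v = 0} = CARD('a) ^ kernel_dim A"
    unfolding setL card_image_shift by (fact cardK[unfolded setK])
  have "(\<lambda>j. \<tau> (Suc j)) = toeplitz_seq l a b"
    unfolding \<tau>_def l by (auto simp: toeplitz_seq_def)
  then have cardB: "card {v \<in> V. \<beta> v = 0 \<and> \<alpha> v = 0} = CARD('a) ^ kernel_dim B"
    using card_annihilated_toeplitz[of l a b]
    unfolding V_def \<alpha>_def \<beta>_def annihilated_outer card_image_shift B by (simp add: l)
  \<comment> \<open>The duality exchanges the roles of \<open>n\<close> rows and \<open>n + 2\<close> columns.\<close>
  have "CARD('a) ^ n * card V = CARD('a) ^ n * ((CARD('a))\<^sup>2 * card (annihilated \<tau> n (Suc (Suc n))))"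
    using card_annihilated_swap[of n \<tau> "Suc (Suc n)"] by (simp add: V_def power2_eq_square)
  then have cardV: "card V = (CARD('a))\<^sup>2
      * card {v \<in> V. (g v = 0 \<and> \<alpha> v = 0) \<and> f v = 0 \<and> \<beta> v = 0}"
    unfolding V_def g_def \<alpha>_def f_def \<beta>_def annihilated_inner card_image_shift by simp
  define M where "M c = card {(x, y).
    card {v \<in> V. f v + x * \<beta> v = 0 \<and> g v + y * \<alpha> v = 0} = CARD('a) ^ c}" for c
  have M: "num_ext_with_nullity n A c = M c" for c
  proof -
    have "card {v \<in> V. f v + x * \<beta> v = 0 \<and> g v + y * \<alpha> v = 0}
        = CARD('a) ^ kernel_dim (toeplitz_mat (Suc n) (a(Suc n := x)) (b(Suc n := y)))" for x y
      unfolding card_annihilated_toeplitz[symmetric] annihilated_extend[of a n, OF a]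
      by (simp only: V_def f_def g_def \<alpha>_def \<beta>_def \<tau>_def)
    then show ?thesis
      unfolding A num_ext_eq_card_pairs M_def by (simp only: poly_space.power_card_inject)
  qed
  have regular: "kernel_dim B = 0 \<Longrightarrow> M 0 = q\<^sup>2 - q + 1" "kernel_dim B = 0 \<Longrightarrow> M 1 = q - 1"
    "kernel_dim B = 1 \<Longrightarrow> M 0 = q\<^sup>2 - q" "kernel_dim B = 1 \<Longrightarrow> M 1 = q"
    if "kernel_dim A = 0"
  proof -
    have "card V = (CARD('a))\<^sup>2"
      using cardK that by (intro poly_space.card_ambient_regular[OF V func _ cardV]) simp
    note * = poly_space.pencil_count_plane[OF V this func
        cardK[unfolded that] cardL[unfolded that] cardB, folded M_def, folded q]
    show "kernel_dim B = 0 \<Longrightarrow> M 0 = q\<^sup>2 - q + 1" "kernel_dim B = 0 \<Longrightarrow> M 1 = q - 1"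
      "kernel_dim B = 1 \<Longrightarrow> M 0 = q\<^sup>2 - q" "kernel_dim B = 1 \<Longrightarrow> M 1 = q"
      by (fact *)+
  qed
  have singular: "kernel_dim B = k \<Longrightarrow> M (Suc (Suc k)) = 1"
    "kernel_dim B = k \<Longrightarrow> M (Suc k) = 2 * q - 2"
    "kernel_dim B = k \<Longrightarrow> M k = (q - 1)\<^sup>2"
    "kernel_dim B = Suc k \<Longrightarrow> M (Suc k) = q"
    "kernel_dim B = Suc k \<Longrightarrow> M k = q\<^sup>2 - q"
    "kernel_dim B = Suc (Suc k) \<Longrightarrow> M k = q\<^sup>2"
    if \<nu>: "kernel_dim A = Suc k" for k
  proof -
    have "\<not> ?K \<subseteq> {0}"
    proof
      assume "?K \<subseteq> {0}"
      from card_mono[OF _ this] have "card ?K \<le> 1" by simp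
      moreover have "1 < CARD('a)" using poly_space.card_ge_2[where 'a = 'a] by simp
      then have "1 < CARD('a) ^ Suc k" by (rule one_less_power) simp
      ultimately show False using cardK unfolding setK \<nu> by linarith
    qed
    then obtain p where "p \<in> ?K" "p \<noteq> 0" by blast
    from shift_not_invariant[OF finite_annihilated this]
    have neq: "{v \<in> V. f v = 0 \<and> \<beta> v = 0} \<noteq> {v \<in> V. g v = 0 \<and> \<alpha> v = 0}"
      unfolding setK setL .
    have "card V = CARD('a) ^ Suc (Suc k)"
      using poly_space.card_ambient_singular[OF V func cardK cardL cardV neq] unfolding \<nu> .
    note * = poly_space.pencil_count_singular[OF V this func
        cardK[unfolded \<nu>] cardL[unfolded \<nu>] neq cardB, folded M_def, folded q]
    show "kernel_dim B = k \<Longrightarrow> M (Suc (Suc k)) = 1"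
      "kernel_dim B = k \<Longrightarrow> M (Suc k) = 2 * q - 2"
      "kernel_dim B = k \<Longrightarrow> M k = (q - 1)\<^sup>2"
      "kernel_dim B = Suc k \<Longrightarrow> M (Suc k) = q"
      "kernel_dim B = Suc k \<Longrightarrow> M k = q\<^sup>2 - q"
      "kernel_dim B = Suc (Suc k) \<Longrightarrow> M k = q\<^sup>2"
      by (fact *)+
  qed
  show ?thesis
    unfolding M
  proof (intro conjI allI impI; elim conjE)
    fix d :: nat assume d: "d \<ge> 1"
    then obtain k where k: "d = Suc k" by (cases d) auto
    show "M (d + 1) = 1" "M d = 2 * q - 2" "M (d - 1) = (q - 1)\<^sup>2"
      if "kernel_dim B = d - 1" "kernel_dim A = d"
      using singular(1-3)[of k] that k by simp_all
    show "M d = q" "M (d - 1) = q\<^sup>2 - q" if "kernel_dim B = d" "kernel_dim A = d"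
      using singular(4,5)[of k] that k by simp_all
  next
    fix d :: nat assume d: "d \<ge> 2" and ker: "kernel_dim B = d" "kernel_dim A = d - 1"
    obtain k where k: "d = Suc (Suc k)" using that[of "d - 2"] d by simp
    show "M (d - 2) = q\<^sup>2" using singular(6)[of k] ker k by simp
  qed (use regular in simp_all)
qed

end
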